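(* Let $n\ge 3$, $S=\mathbb{C}[x_1,\dots,x_n]$, $a\in\mathbb{N}$, and let $m$ be a positive integer with $m<n-1$. Then the ideal $I=\langle p_a,p_{2a},\dots,p_{ma}\rangle$ is a prime ideal of $S$.
   Context: $p_d=\sum_{i=1}^n x_i^d$ denotes the power sum symmetric polynomial of degree $d$; $\mathbb{N}$ is the set of positive integers. *)

theory Defs
  imports Complex_Main "HOL-Library.Poly_Mapping"
begin

text \<open>Polynomial ring C[x_i : i in 'n] for a finite index type 'n:
  polynomials are finitely supported maps from monomials (exponent vectors
  'n =>0 nat) to complex coefficients; multiplication is convolution.\<close>

type_synonym 'n cpoly = "('n \<Rightarrow>\<^sub>0 nat) \<Rightarrow>\<^sub>0 complex"

definition var :: "'n \<Rightarrow> 'n cpoly" where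
  "var i = Poly_Mapping.single (Poly_Mapping.single i 1) 1"

definition power_sum :: "nat \<Rightarrow> ('n::finite) cpoly" where
  "power_sum d = (\<Sum>i\<in>UNIV. var i ^ d)"

definition is_ideal :: "'a::comm_ring_1 set \<Rightarrow> bool" where
  "is_ideal I \<longleftrightarrow> 0 \<in> I \<and> (\<forall>x\<in>I. \<forall>y\<in>I. x + y \<in> I) \<and> (\<forall>r. \<forall>x\<in>I. r * x \<in> I)"

definition ideal_gen :: "'a::comm_ring_1 set \<Rightarrow> 'a set" where
  "ideal_gen A = \<Inter>{I. is_ideal I \<and> A \<subseteq> I}"

definition prime_ideal :: "'a::comm_ring_1 set \<Rightarrow> bool" where
  "prime_ideal I \<longleftrightarrow> is_ideal I \<and> I \<noteq> UNIV \<and> (\<forall>x y. x * y \<in> I \<longrightarrow> x \<in> I \<or> y \<in> I)"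

end

theory Submission
  imports Defs "HOL-Computational_Algebra.Fundamental_Theorem_Algebra"
    "HOL-Computational_Algebra.Polynomial_FPS" "HOL-Combinatorics.Permutations"
begin

text \<open>
  Put \<open>y\<^sub>i = x\<^sub>i\<^sup>a\<close> and let \<open>h\<^sub>k(A)\<close> be the complete homogeneous polynomial of degree \<open>k\<close> in
  the \<open>y\<^sub>i\<close>, \<open>i \<in> A\<close>. By Newton's identities the ideal \<open>I\<close> contains \<open>h\<^sub>k(A)\<close> whenever
  \<open>n - |A| < k \<le> m\<close>, so modulo \<open>I\<close> all but \<open>n - m\<close> ``free'' variables can be reduced one after the
  other by monic polynomials.

  Fix a complex point \<open>\<rho>\<close> on the variety of \<open>I\<close> whose dependent coordinates have distinct nonzero
  \<open>a\<close>-th powers, deform its free coordinates generically to \<open>\<rho>\<^sub>i + u v\<^sub>i\<close>, and lift the dependent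
  coordinates to power series in \<open>u\<close> over \<open>\<complex>[v]\<close> by Hensel's lemma. A polynomial lies in \<open>I\<close> iff
  it vanishes at all points obtained from this one by permuting the dependent coordinates and
  scaling them by \<open>a\<close>-th roots of unity, because a reduced polynomial has fewer roots than that.

  If \<open>s\<close> is a transposition of two variables or the scaling of one variable by a root of unity,
  \<open>\<rho>\<close> can be chosen on the mirror of \<open>s\<close>, as the roots of \<open>T\<^sup>n - n T + (n - 1)\<close> or of \<open>T\<^sup>n - T\<close>.
  Then \<open>s\<close> acts on each of these points like an automorphism of the power series domain, so
  \<open>f g \<in> I\<close> implies \<open>f \<cdot> s(g) \<in> I\<close>. Such \<open>s\<close> generate the full monomial group, hence
  \<open>w(f) \<cdot> w'(g) \<in> I\<close> for all \<open>w\<close>, \<open>w'\<close> in it. Evaluating at one point shows that \<open>f\<close> or \<open>g\<close>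
  vanishes at all of its conjugates.
\<close>

section \<open>Evaluation of polynomials\<close>

locale rhom =
  fixes f :: "'a::comm_ring_1 \<Rightarrow> 'b::comm_ring_1"
  assumes hom_add: "f (x + y) = f x + f y"
    and hom_mult: "f (x * y) = f x * f y"
    and hom_one: "f 1 = 1"
begin

lemma hom_zero: "f 0 = 0"
  using hom_add[of 0 0] by simp

lemma hom_minus: "f (- x) = - f x"
  using hom_add[of x "- x"] hom_zero by (simp add: eq_neg_iff_add_eq_0 add.commute)

lemma hom_power: "f (x ^ k) = f x ^ k"
  by (induction k) (simp_all add: hom_one hom_mult)

lemma hom_sum: "f (sum g A) = (\<Sum>i\<in>A. f (g i))"
  by (induction A rule: infinite_finite_induct) (simp_all add: hom_zero hom_add)

lemma hom_of_nat: "f (of_nat k) = of_nat k"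
  by (induction k) (simp_all add: hom_zero hom_one hom_add)

lemma hom_poly: "f (poly p x) = poly (map_poly f p) (f x)"
  by (induction p) (simp_all add: map_poly_pCons hom_zero hom_add hom_mult)

end

lemma rhom_comp: "rhom f \<Longrightarrow> rhom g \<Longrightarrow> rhom (\<lambda>x. f (g x))"
  by (simp add: rhom_def)

lemma rhom_id: "rhom (\<lambda>x. x)"
  by (simp add: rhom_def)

lemma poly_mapping_induct_single_add [case_names single add]:
  fixes F :: "'a \<Rightarrow>\<^sub>0 'b::comm_monoid_add"
  assumes "\<And>k c. P (Poly_Mapping.single k c)"
    and "\<And>F G. P F \<Longrightarrow> P G \<Longrightarrow> P (F + G)"
  shows "P F"
proof -
  have "P (\<Sum>k\<in>A. Poly_Mapping.single k (g k))" for A and g :: "'a \<Rightarrow> 'b"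
  proof (induction A rule: infinite_finite_induct)
    case (insert x A)
    then show ?case by (simp add: assms)
  qed (use assms(1)[of undefined 0] in simp_all)
  moreover have "F = (\<Sum>k\<in>Poly_Mapping.keys F. Poly_Mapping.single k (Poly_Mapping.lookup F k))"
    by (rule poly_mapping_eqI)
      (simp add: lookup_sum lookup_single when_def in_keys_iff)
  ultimately show ?thesis by metis
qed

definition Const :: "complex \<Rightarrow> 'k cpoly" where
  "Const = Poly_Mapping.single 0"

lemma rhom_Const: "rhom Const"
  by unfold_locales (simp_all add: Const_def single_add mult_single)

lemma Const_eq_iff: "Const c = Const d \<longleftrightarrow> c = d"
  unfolding Const_def by (metis lookup_single_eq)

definition mon_eval :: "('k \<Rightarrow> 'b::comm_ring_1) \<Rightarrow> ('k \<Rightarrow>\<^sub>0 nat) \<Rightarrow> 'b" where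
  "mon_eval \<xi> u = (\<Prod>i\<in>Poly_Mapping.keys u. \<xi> i ^ Poly_Mapping.lookup u i)"

text \<open>The coefficient map \<open>c\<close> is a parameter, so that one construction covers
  substitution into polynomials (\<open>Const\<close>) and evaluation in power series
  (\<open>scal\<close>).\<close>

definition ev :: "(complex \<Rightarrow> 'b::comm_ring_1) \<Rightarrow> ('k \<Rightarrow> 'b) \<Rightarrow> 'k cpoly \<Rightarrow> 'b" where
  "ev c \<xi> F = (\<Sum>u\<in>Poly_Mapping.keys F. c (Poly_Mapping.lookup F u) * mon_eval \<xi> u)"

lemma mon_eval_superset:
  assumes "finite A" "Poly_Mapping.keys u \<subseteq> A"
  shows "mon_eval \<xi> u = (\<Prod>i\<in>A. \<xi> i ^ Poly_Mapping.lookup u i)"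
  unfolding mon_eval_def using assms
  by (intro prod.mono_neutral_left) (auto simp: in_keys_iff)

lemma mon_eval_add: "mon_eval \<xi> (u + v) = mon_eval \<xi> u * mon_eval \<xi> v"
proof -
  let ?A = "Poly_Mapping.keys u \<union> Poly_Mapping.keys v"
  have "Poly_Mapping.keys (u + v) \<subseteq> ?A" by (rule Poly_Mapping.keys_add)
  then show ?thesis
    by (simp add: mon_eval_superset[of ?A] lookup_add power_add prod.distrib)
qed

lemma ev_superset:
  assumes "finite A" "Poly_Mapping.keys F \<subseteq> A" "c 0 = 0"
  shows "ev c \<xi> F = (\<Sum>u\<in>A. c (Poly_Mapping.lookup F u) * mon_eval \<xi> u)"
  unfolding ev_def using assms
  by (intro sum.mono_neutral_left) (auto simp: in_keys_iff)

lemma ev_single: "c 0 = 0 \<Longrightarrow> ev c \<xi> (Poly_Mapping.single u x) = c x * mon_eval \<xi> u"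
  by (subst ev_superset[of "{u}"]) auto

lemma rhom_ev:
  assumes "rhom c" shows "rhom (ev c \<xi>)"
proof
  interpret rhom c by fact
  show add: "ev c \<xi> (F + G) = ev c \<xi> F + ev c \<xi> G" for F G
  proof -
    let ?A = "Poly_Mapping.keys F \<union> Poly_Mapping.keys G"
    have "Poly_Mapping.keys (F + G) \<subseteq> ?A" by (rule Poly_Mapping.keys_add)
    then show ?thesis
      by (simp add: ev_superset[of ?A] hom_zero hom_add lookup_add algebra_simps sum.distrib)
  qed
  show "ev c \<xi> 1 = 1"
    using ev_single[of c \<xi> 0 1] by (simp add: hom_zero hom_one mon_eval_def)
  show "ev c \<xi> (F * G) = ev c \<xi> F * ev c \<xi> G" for F G
  proof (induction F rule: poly_mapping_induct_single_add)
    case (single u x)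
    show ?case
      by (induction G rule: poly_mapping_induct_single_add)
        (simp_all add: add algebra_simps mult_single ev_single hom_zero hom_mult mon_eval_add)
  qed (simp add: add algebra_simps)
qed

lemma ev_Const: "rhom c \<Longrightarrow> ev c \<xi> (Const x) = c x"
  by (simp add: Const_def ev_single rhom.hom_zero mon_eval_def)

lemma ev_var: "rhom c \<Longrightarrow> ev c \<xi> (var i) = \<xi> i"
  by (simp add: var_def ev_single rhom.hom_zero rhom.hom_one mon_eval_def)

text \<open>The subring generated by the variables in \<open>A\<close>. Multiplication is a rule
  only for single variables, so an induction such as the one in \<open>reduce_mod_monic\<close>
  needs closure under these alone.\<close>

inductive_set polys_in :: "'k set \<Rightarrow> 'k cpoly set" for A where
  Const: "Const c \<in> polys_in A"
| add: "F \<in> polys_in A \<Longrightarrow> G \<in> polys_in A \<Longrightarrow> F + G \<in> polys_in A"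
| var_mult: "F \<in> polys_in A \<Longrightarrow> i \<in> A \<Longrightarrow> var i * F \<in> polys_in A"

lemma polys_in_mult:
  assumes "F \<in> polys_in A" "G \<in> polys_in A" shows "F * G \<in> polys_in A"
  using assms(1)
proof (induction)
  case (Const c)
  show ?case using assms(2)
  proof induction
    case (Const d)
    then show ?case by (metis rhom.hom_mult[OF rhom_Const] polys_in.Const)
  next
    case (add F G)
    then show ?case by (simp add: distrib_left polys_in.add)
  next
    case (var_mult F i)
    then show ?case by (metis mult.left_commute polys_in.var_mult)
  qed
next
  case (add F G)
  then show ?case by (simp add: distrib_right polys_in.add)
next
  case (var_mult F i)
  then show ?case by (metis mult.assoc polys_in.var_mult)
qed

lemma polys_in_1: "1 \<in> polys_in A"
  by (metis rhom.hom_one[OF rhom_Const] polys_in.Const)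

lemma polys_in_0: "0 \<in> polys_in A"
  by (metis rhom.hom_zero[OF rhom_Const] polys_in.Const)

lemma polys_in_var: "i \<in> A \<Longrightarrow> var i \<in> polys_in A"
  using polys_in.var_mult[OF polys_in_1] by fastforce

lemma polys_in_power: "F \<in> polys_in A \<Longrightarrow> F ^ k \<in> polys_in A"
  by (induction k) (simp_all add: polys_in_1 polys_in_mult)

lemma polys_in_uminus: "F \<in> polys_in A \<Longrightarrow> - F \<in> polys_in A"
proof -
  have "- 1 = Const (- 1)"
    by (simp add: rhom.hom_minus[OF rhom_Const] rhom.hom_one[OF rhom_Const])
  then show "F \<in> polys_in A \<Longrightarrow> - F \<in> polys_in A"
    by (metis mult_minus1 polys_in.Const polys_in_mult)
qed

lemma polys_in_sum: "(\<And>i. i \<in> B \<Longrightarrow> g i \<in> polys_in A) \<Longrightarrow> sum g B \<in> polys_in A"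
  by (induction B rule: infinite_finite_induct) (simp_all add: polys_in_0 polys_in.add)

lemma polys_in_UNIV: "F \<in> polys_in UNIV"
proof (induction F rule: poly_mapping_induct_single_add)
  case (single u c)
  have pow: "Poly_Mapping.single (Poly_Mapping.single i k) 1 = var i ^ k" for i :: 'a and k
  proof (induction k)
    case (Suc k)
    have "Poly_Mapping.single i (Suc k) = Poly_Mapping.single i 1 + Poly_Mapping.single i k"
      by (simp flip: single_add)
    then have "Poly_Mapping.single (Poly_Mapping.single i (Suc k)) 1 = var i * Poly_Mapping.single (Poly_Mapping.single i k) 1"
      by (simp add: var_def mult_single)
    then show ?case using Suc by simp
  qed simp
  have "Poly_Mapping.single u 1 * F \<in> polys_in UNIV" if "F \<in> polys_in UNIV" for F
    using that
  proof (induction u arbitrary: F rule: poly_mapping_induct_single_add)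
    case (single i k)
    then show ?case by (simp add: pow polys_in_mult polys_in_power polys_in_var)
  next
    case (add u v)
    have "Poly_Mapping.single (u + v) 1 * F = Poly_Mapping.single u 1 * (Poly_Mapping.single v 1 * F)"
      by (simp add: mult_single flip: mult.assoc)
    with add show ?case by simp
  qed
  from this[OF polys_in.Const[of c]] show ?case by (simp add: Const_def mult_single)
qed (rule polys_in.add)

lemma rhom_eq_on_polys_in:
  assumes "rhom f" "rhom g" "\<And>c. f (Const c) = g (Const c)"
    and "\<And>i. i \<in> A \<Longrightarrow> f (var i) = g (var i)" and "F \<in> polys_in A"
  shows "f F = g F"
  using assms(5)
  by induction (simp_all add: assms rhom.hom_add[OF assms(1)] rhom.hom_add[OF assms(2)]
      rhom.hom_mult[OF assms(1)] rhom.hom_mult[OF assms(2)])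

lemma rhom_ev_comp:
  assumes "rhom \<psi>" "rhom c"
  shows "\<psi> (ev c \<xi> F) = ev (\<lambda>x. \<psi> (c x)) (\<lambda>i. \<psi> (\<xi> i)) F"
  by (rule rhom_eq_on_polys_in[OF _ _ _ _ polys_in_UNIV])
    (simp_all add: assms rhom_ev rhom_comp ev_Const ev_var)

section \<open>Complete homogeneous symmetric polynomials\<close>

definition geom :: "'a::comm_ring_1 \<Rightarrow> 'a fps" where
  "geom y = Abs_fps (\<lambda>k. y ^ k)"

text \<open>The product of the series 1 / (1 - y_i T), whose coefficients are the complete
  homogeneous symmetric polynomials in the \<open>y i\<close>.\<close>

definition hfps :: "('i \<Rightarrow> 'a::comm_ring_1) \<Rightarrow> 'i set \<Rightarrow> 'a fps" where
  "hfps y A = (\<Prod>i\<in>A. geom (y i))"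

definition hsym :: "nat \<Rightarrow> ('i \<Rightarrow> 'a::comm_ring_1) \<Rightarrow> 'i set \<Rightarrow> 'a" where
  "hsym k y A = fps_nth (hfps y A) k"

lemma geom_inverse: "(1 - fps_const y * fps_X) * geom y = 1"
proof (rule fps_ext)
  fix k
  have "(1 - fps_const y * fps_X) * geom y = geom y - fps_const y * (fps_X * geom y)"
    by (simp add: algebra_simps)
  then show "fps_nth ((1 - fps_const y * fps_X) * geom y) k = fps_nth 1 k"
    by (cases k) (simp_all add: geom_def)
qed

lemma fps_deriv_geom: "fps_deriv (geom y) = geom y * (fps_const y * geom y)"
proof -
  let ?L = "1 - fps_const y * fps_X"
  have "fps_deriv (?L * geom y) = 0" by (simp only: geom_inverse) simp
  moreover have "fps_deriv ?L = - fps_const y" by simp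
  ultimately have "?L * fps_deriv (geom y) = fps_const y * geom y"
    by (simp only: fps_deriv_mult mult_minus_left add_uminus_conv_diff right_minus_eq)
  then have "geom y * (?L * fps_deriv (geom y)) = geom y * (fps_const y * geom y)" by (simp only:)
  moreover have "geom y * (?L * fps_deriv (geom y)) = (?L * geom y) * fps_deriv (geom y)"
    by (simp only: mult_ac)
  ultimately show ?thesis by (simp only: geom_inverse mult_1)
qed

lemma hsym_0: "hsym 0 y A = 1"
proof -
  have "fps_nth (\<Prod>i\<in>A. geom (y i)) 0 = 1"
    by (induction A rule: infinite_finite_induct) (simp_all add: geom_def)
  then show ?thesis by (simp add: hsym_def hfps_def)
qed

lemma hsym_insert:
  assumes "finite A" "x \<notin> A"
  shows "hsym k y (insert x A) = (\<Sum>i\<le>k. y x ^ i * hsym (k - i) y A)"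
  using assms by (simp add: hsym_def hfps_def fps_mult_nth geom_def atMost_atLeast0)

text \<open>Multiplying the generating series by 1 - y_x T cancels the factor belonging to
  \<open>x\<close>.\<close>

lemma hsym_remove:
  assumes "finite A" "x \<notin> A"
  shows "hsym (Suc k) y A = hsym (Suc k) y (insert x A) - y x * hsym k y (insert x A)"
proof -
  have "(1 - fps_const (y x) * fps_X) * hfps y (insert x A) = hfps y A"
    using assms by (simp add: hfps_def geom_inverse flip: mult.assoc)
  then have "hfps y A = hfps y (insert x A) - fps_const (y x) * (fps_X * hfps y (insert x A))"
    by (simp add: algebra_simps)
  then show ?thesis by (simp add: hsym_def)
qed

lemma fps_deriv_hfps:
  assumes "finite A"
  shows "fps_deriv (hfps y A) = hfps y A * (\<Sum>i\<in>A. fps_const (y i) * geom (y i))"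
  using assms
  by induction (simp_all add: hfps_def fps_deriv_geom algebra_simps)

text \<open>Compare coefficients in H' = H * S with S the sum of y_i / (1 - y_i T), the logarithmic
  derivative of the generating series H.\<close>

lemma newton_hsym:
  assumes "finite A"
  shows "of_nat (Suc k) * hsym (Suc k) y A = (\<Sum>j\<le>k. hsym j y A * (\<Sum>i\<in>A. y i ^ (Suc (k - j))))"
proof -
  have "of_nat (Suc k) * hsym (Suc k) y A = fps_nth (fps_deriv (hfps y A)) k"
    by (simp add: hsym_def)
  also have "\<dots> = (\<Sum>j\<le>k. hsym j y A * (\<Sum>i\<in>A. y i ^ (Suc (k - j))))"
    unfolding fps_deriv_hfps[OF assms]
    by (simp add: fps_mult_nth[of "hfps y A"] hsym_def fps_sum_nth geom_def atMost_atLeast0)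
  finally show ?thesis .
qed

lemma hsym_cong: "(\<And>i. i \<in> A \<Longrightarrow> y i = y' i) \<Longrightarrow> hsym k y A = hsym k y' A"
  unfolding hsym_def hfps_def by (metis (mono_tags, lifting) prod.cong)

lemma hsym_permutes: "p permutes A \<Longrightarrow> hsym k (\<lambda>i. y (p i)) A = hsym k y A"
  unfolding hsym_def hfps_def using prod.permute[of p A "\<lambda>i. geom (y i)"] by (simp add: o_def)

lemma hom_hsym:
  assumes "rhom f" "finite A"
  shows "f (hsym k y A) = hsym k (\<lambda>i. f (y i)) A"
  using assms(2)
proof (induction arbitrary: k)
  case empty
  then show ?case
    by (cases k) (simp_all add: hsym_def hfps_def rhom.hom_one[OF assms(1)] rhom.hom_zero[OF assms(1)])
next
  case (insert x A)
  then show ?case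
    by (simp add: hsym_insert rhom.hom_sum[OF assms(1)] rhom.hom_mult[OF assms(1)]
        rhom.hom_power[OF assms(1)])
qed

lemma power_sum_eq_0_if_hsym_eq_0:
  assumes "finite A" and h: "\<And>k. 1 \<le> k \<Longrightarrow> k \<le> m \<Longrightarrow> hsym k y A = 0"
    and k: "1 \<le> k" "k \<le> m"
  shows "(\<Sum>i\<in>A. y i ^ k) = 0"
proof -
  obtain l where l: "k = Suc l" using k by (cases k) auto
  have "0 = (\<Sum>j\<le>l. hsym j y A * (\<Sum>i\<in>A. y i ^ (Suc (l - j))))"
    using newton_hsym[OF assms(1), of l y] h[of "Suc l"] k l by simp
  also have "\<dots> = (\<Sum>j\<le>l. if j = 0 then \<Sum>i\<in>A. y i ^ Suc l else 0)"
    using h k l by (intro sum.cong) (auto simp: hsym_0)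
  finally show ?thesis by (simp add: l)
qed

text \<open>Passing from \<open>insert x A\<close> to \<open>A\<close> raises the least degree in which the complete homogeneous
  polynomials lie in \<open>J\<close> by one.\<close>

lemma hsym_mem_ideal:
  fixes J :: "'a::comm_ring_1 set" and y :: "'i::finite \<Rightarrow> 'a"
  assumes J: "is_ideal J" and inv: "\<And>k. 1 \<le> k \<Longrightarrow> \<exists>r::'a. r * of_nat k = 1"
    and p: "\<And>k. 1 \<le> k \<Longrightarrow> k \<le> m \<Longrightarrow> (\<Sum>i\<in>UNIV. y i ^ k) \<in> J"
    and k: "card (UNIV :: 'i set) - card A < k" "k \<le> m"
  shows "hsym k y A \<in> J"
proof -
  have add: "u + v \<in> J" and mult: "r * u \<in> J" if "u \<in> J" "v \<in> J" for u v r
    using J that by (auto simp: is_ideal_def)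
  have diff: "u - v \<in> J" if "u \<in> J" "v \<in> J" for u v
    using add[of u "(- 1) * v"] mult[of v v "- 1"] that by simp
  have sum: "sum g B \<in> J" if "\<And>i. i \<in> B \<Longrightarrow> g i \<in> J" for g and B :: "nat set"
    using that J by (induction B rule: infinite_finite_induct) (auto simp: is_ideal_def)
  \<comment> \<open>Induction on the number \<open>d\<close> of missing variables. The base case is
    Newton's identity divided by \<open>k\<close>; in the step, \<open>hsym_remove\<close> puts
    \<open>x\<close> back, and both \<open>k\<close> and \<open>k - 1\<close> exceed the size of the
    smaller complement.\<close>
  have "hsym k y A \<in> J" if "card (- A) = d" "d < k" "k \<le> m" for d
    using that
  proof (induction d arbitrary: A k)
    case 0
    then have A: "A = UNIV" by (metis card_0_eq finite double_complement Compl_empty_eq)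
    obtain l where l: "k = Suc l" using 0 by (cases k) auto
    obtain r where r: "r * of_nat (Suc l) = (1::'a)" using inv[of "Suc l"] by auto
    have "(\<Sum>j\<le>l. hsym j y A * (\<Sum>i\<in>A. y i ^ (Suc (l - j)))) \<in> J"
    proof (intro sum mult)
      fix j assume "j \<in> {..l}"
      then show "(\<Sum>i\<in>A. y i ^ (Suc (l - j))) \<in> J"
        unfolding A using 0 l by (intro p) auto
      then show "(\<Sum>i\<in>A. y i ^ (Suc (l - j))) \<in> J" .
    qed
    then have "r * (of_nat (Suc l) * hsym (Suc l) y A) \<in> J"
      using mult newton_hsym[of A l y] by simp
    then show ?case using r l by (metis mult.assoc mult_1)
  next
    case (Suc d)
    then obtain x where x: "x \<notin> A" by (metis card.empty Compl_iff ex_in_conv nat.distinct(1))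
    have "card (- insert x A) = d"
      using Suc.prems x by (metis Compl_iff Compl_insert card_Diff_singleton diff_Suc_1)
    moreover obtain l where l: "k = Suc l" using Suc.prems by (cases k) auto
    ultimately show ?case
      using hsym_remove[OF _ x, of l y] Suc.IH[of "insert x A" l] Suc.IH[of "insert x A" k] Suc.prems
      by (auto intro!: diff mult)
  qed
  moreover have "card (- A) = card (UNIV :: 'i set) - card A" by (simp add: Compl_eq_Diff_UNIV card_Diff_subset)
  ultimately show ?thesis using k by blast
qed

section \<open>Products of linear factors and vanishing complete homogeneous polynomials\<close>

lemma degree_prod_linear_le: "degree (\<Prod>i\<in>B. [:- y i, 1::'a::comm_ring_1:]) \<le> card B"
proof (induction B rule: infinite_finite_induct)
  case (insert x B)
  have "degree ([:- y x, 1:] * (\<Prod>i\<in>B. [:- y i, 1:])) \<le> 1 + card B"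
    using insert.IH by (intro order.trans[OF degree_mult_le] add_mono) auto
  then show ?case using insert by simp
qed auto

text \<open>The left product is the reciprocal polynomial of the right one. Adding a factor gives
  both the same recursion; \<open>k = 0\<close> and \<open>k = Suc (card B)\<close> are separate
  because one of its two terms is then out of range.\<close>

lemma fps_nth_prod_linear:
  fixes y :: "'i \<Rightarrow> 'a::comm_ring_1"
  assumes "finite B" "k \<le> card B"
  shows "fps_nth (\<Prod>i\<in>B. 1 - fps_const (y i) * fps_X) k = coeff (\<Prod>i\<in>B. [:- y i, 1:]) (card B - k)"
  using assms
proof (induction arbitrary: k)
  case (insert x B)
  let ?E = "\<Prod>i\<in>B. 1 - fps_const (y i) * fps_X" and ?P = "\<Prod>i\<in>B. [:- y i, 1:]"
  have E: "fps_nth ((1 - fps_const (y x) * fps_X) * ?E) k = 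
    fps_nth ?E k - y x * (if k = 0 then 0 else fps_nth ?E (k - 1))" for k
    by (simp add: left_diff_distrib mult.assoc)
  have z: "coeff ?P (Suc (card B)) = 0"
    using degree_prod_linear_le[of y B] by (intro coeff_eq_0) auto
  have z': "fps_nth ?E (Suc (card B)) = 0"
  proof -
    have "fps_nth (\<Prod>i\<in>C. 1 - fps_const (y i) * fps_X) k = 0" if "finite C" "k > card C" for C k
      using that
    proof (induction arbitrary: k)
      case (insert x C)
      then show ?case by (simp add: left_diff_distrib mult.assoc)
    qed simp
    then show ?thesis using insert by simp
  qed
  consider "k = 0" | "k = Suc (card B)" | l where "k = Suc l" "l < card B"
    using insert.prems insert.hyps by (cases k) fastforce+
  then show ?case
  proof cases
    case 1
    then show ?thesis using insert.IH[of 0] insert.hyps z by (simp add: E)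
  next
    case 2
    then show ?thesis using insert.IH[of "card B"] insert.hyps z' by (simp add: E)
  next
    case (3 l)
    then have "card B - l = Suc (card B - Suc l)" by simp
    then show ?thesis using insert.IH[of l] insert.IH[of "Suc l"] insert.hyps 3
      by (simp add: E)
  qed
qed simp

text \<open>Let E be the product of 1 - y_i T over \<open>B\<close>, and let H denote generating
  series. Then E * H_(A \<union> B) = H_A, and E agrees with H_A up to degree \<open>m\<close>, so
  H_(A \<union> B) is 1 modulo T^(m+1).\<close>

lemma hsym_eq_0_if_coeffs_prod:
  assumes "finite A" "finite B" "A \<inter> B = {}"
    and coeffs: "\<And>i. i \<le> m \<Longrightarrow> coeff (\<Prod>i\<in>B. [:- y i, 1:]) (card B - i) = hsym i y A"
    and "m \<le> card B" "1 \<le> k" "k \<le> m"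
  shows "hsym k y (A \<union> B) = 0"
proof -
  let ?E = "\<Prod>i\<in>B. 1 - fps_const (y i) * fps_X"
  have "?E * hfps y B = 1"
    by (simp add: hfps_def geom_inverse flip: prod.distrib)
  moreover have "hfps y (A \<union> B) = hfps y A * hfps y B"
    using assms(1-3) by (simp add: hfps_def prod.union_disjoint)
  then have "?E * hfps y (A \<union> B) = (?E * hfps y B) * hfps y A"
    by (simp only: mult_ac)
  ultimately have eq: "?E * hfps y (A \<union> B) = hfps y A" by (simp only: mult_1)
  have E: "fps_nth ?E i = hsym i y A" if "i \<le> m" for i
    using that coeffs[of i] fps_nth_prod_linear[OF assms(2), of i y] assms(5) by simp
  show ?thesis using assms(6,7)
  proof (induction k rule: less_induct)
    case (less k)
    have "hsym k y A = fps_nth (?E * hfps y (A \<union> B)) k" by (simp only: eq hsym_def)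
    also have "\<dots> = (\<Sum>i\<le>k. hsym i y A * hsym (k - i) y (A \<union> B))"
      using less.prems unfolding fps_mult_nth atMost_atLeast0
      by (intro sum.cong) (auto simp: E hsym_def)
    \<comment> \<open>The middle terms vanish by induction; the term \<open>i = k\<close> will
      cancel against the left-hand side.\<close>
    also have "\<dots> = (\<Sum>i\<in>{0,k}. hsym i y A * hsym (k - i) y (A \<union> B))"
    proof (intro sum.mono_neutral_right ballI)
      fix i assume "i \<in> {..k} - {0, k}"
      then show "hsym i y A * hsym (k - i) y (A \<union> B) = 0"
        using less.IH[of "k - i"] less.prems by (cases "k - i") auto
    qed auto
    also have "\<dots> = hsym k y (A \<union> B) + hsym k y A"
      using less.prems by (simp add: hsym_0)
    finally show ?case by simp
  qed
qed

section \<open>Hensel's lemma for power series\<close>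

lemma poly_taylor2:
  fixes p :: "'a::idom poly"
  shows "\<exists>r. poly p (x + d) = poly p x + d * poly (pderiv p) x + d * d * r"
proof (induction p)
  case (pCons c p)
  then obtain r where r: "poly p (x + d) = poly p x + d * poly (pderiv p) x + d * d * r" by blast
  have "poly (pCons c p) (x + d) = poly (pCons c p) x + d * poly (pderiv (pCons c p)) x
      + d * d * (poly (pderiv p) x + d * r + x * r)"
    unfolding poly_pCons r pderiv_pCons poly_add by (simp add: algebra_simps)
  then show ?case by blast
qed simp

lemma rhom_fps_nth_0: "rhom (\<lambda>f :: 'a::comm_ring_1 fps. fps_nth f 0)"
  by unfold_locales simp_all

lemma fps_nth_0_poly: "fps_nth (poly p x) 0 = poly (map_poly (\<lambda>f. fps_nth f 0) p) (fps_nth x 0)"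
  for p :: "'a::comm_ring_1 fps poly"
  by (rule rhom.hom_poly[OF rhom_fps_nth_0])


text \<open>Divisibility by \<open>fps_X ^ k\<close>. Unlike a bound on \<open>subdegree\<close>, it
  holds for the zero series at every \<open>k\<close>.\<close>

definition fps_low :: "nat \<Rightarrow> 'a::comm_ring_1 fps \<Rightarrow> bool" where
  "fps_low k f \<longleftrightarrow> (\<forall>j<k. fps_nth f j = 0)"

lemma fps_low_add: "fps_low k f \<Longrightarrow> fps_low k g \<Longrightarrow> fps_low k (f + g)"
  by (simp add: fps_low_def)

lemma fps_low_mult:
  assumes "fps_low k f" "fps_low l g" shows "fps_low (k + l) (f * g)"
  unfolding fps_low_def
proof safe
  fix j assume "j < k + l"
  then have "fps_nth f i * fps_nth g (j - i) = 0" if "i \<le> j" for i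
    using assms that by (cases "i < k") (auto simp: fps_low_def)
  then show "fps_nth (f * g) j = 0"
    unfolding fps_mult_nth by (intro sum.neutral) auto
qed

lemma fps_low_mono: "fps_low k f \<Longrightarrow> l \<le> k \<Longrightarrow> fps_low l f"
  by (simp add: fps_low_def)

lemma fps_low_0: "fps_low 0 f"
  by (simp add: fps_low_def)

text \<open>By Taylor expansion, d = x' - x satisfies d * (p'(x) + d r) = 0. The constant term of d
  is zero, so that of the second factor is nonzero, and d = 0 because the ring is a domain.\<close>

lemma hensel_unique:
  fixes p :: "'a::idom fps poly"
  assumes "poly p x = 0" "poly p x' = 0" "fps_nth x 0 = fps_nth x' 0"
    and "fps_nth (poly (pderiv p) x) 0 \<noteq> 0"
  shows "x = x'"
proof (rule ccontr)
  assume ne: "x \<noteq> x'"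
  obtain r where "poly p (x + (x' - x)) = poly p x + (x' - x) * poly (pderiv p) x + (x' - x) * (x' - x) * r"
    using poly_taylor2 by blast
  then have "(x' - x) * (poly (pderiv p) x + (x' - x) * r) = 0"
    using assms(1,2) by (simp add: algebra_simps)
  then have "poly (pderiv p) x + (x' - x) * r = 0" using ne by simp
  then have "fps_nth (poly (pderiv p) x + (x' - x) * r) 0 = 0" by (simp only:) simp
  then show False using assms(3,4) by simp
qed

text \<open>Newton iteration with the inverse \<open>i\<close> of the derivative frozen at the
  starting value: each step gains one order of vanishing.\<close>

lemma hensel_exists:
  fixes p :: "'a::idom fps poly"
  assumes root: "fps_nth (poly p (fps_const c)) 0 = 0"
    and unit: "i * fps_nth (poly (pderiv p) (fps_const c)) 0 = 1"
  shows "\<exists>x. poly p x = 0 \<and> fps_nth x 0 = c"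
proof -
  define \<phi> where "\<phi> x = x - fps_const i * poly p x" for x
  define s where "s k = (\<phi> ^^ k) (fps_const c)" for k
  have nth0: "fps_nth (s k) 0 = c \<and> fps_low (Suc k) (poly p (s k))" for k
  proof (induction k)
    case 0
    then show ?case using root by (simp add: s_def fps_low_def)
  next
    case (Suc k)
    define d where "d = - (fps_const i * poly p (s k))"
    have s: "s (Suc k) = s k + d" by (simp add: s_def \<phi>_def d_def)
    have d: "fps_low (Suc k) d"
      using fps_low_mult[OF fps_low_0 conjunct2[OF Suc], of "fps_const i"]
      by (simp add: d_def fps_low_def)
    obtain r where "poly p (s k + d) = poly p (s k) + d * poly (pderiv p) (s k) + d * d * r"
      using poly_taylor2 by blast
    \<comment> \<open>The bracket has zero constant term because \<open>i\<close> inverts that of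
      the derivative, so the first summand gains one order; \<open>d * d\<close> has order at least
      2k + 2.\<close>
    then have eq: "poly p (s k + d) =
        poly p (s k) * (1 - fps_const i * poly (pderiv p) (s k)) + d * d * r"
      by (simp add: d_def algebra_simps)
    have "fps_nth (poly (pderiv p) (s k)) 0 = fps_nth (poly (pderiv p) (fps_const c)) 0"
      using Suc by (simp add: fps_nth_0_poly)
    then have "fps_low 1 (1 - fps_const i * poly (pderiv p) (s k))"
      using unit by (simp add: fps_low_def)
    from fps_low_mult[OF conjunct2[OF Suc] this]
    have "fps_low (Suc (Suc k)) (poly p (s k) * (1 - fps_const i * poly (pderiv p) (s k)))" by simp
    moreover have "fps_low (Suc (Suc k)) (d * d * r)"
      using fps_low_mult[OF fps_low_mult[OF d d] fps_low_0, of r] by (rule fps_low_mono) simp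
    ultimately have "fps_low (Suc (Suc k)) (poly p (s (Suc k)))"
      unfolding s eq by (rule fps_low_add)
    moreover have "fps_nth (s (Suc k)) 0 = c" using Suc d by (simp add: s fps_low_def)
    ultimately show ?case by simp
  qed
  have step: "fps_nth (s (Suc k)) j = fps_nth (s k) j" if "j \<le> k" for j k
    using fps_low_mult[OF fps_low_0 conjunct2[OF nth0[of k]], of "fps_const i"] that
    by (simp add: s_def \<phi>_def fps_low_def)
  have stable: "fps_nth (s (k + l)) j = fps_nth (s k) j" if "j \<le> k" for j k l
    using that by (induction l) (simp_all add: step)
  \<comment> \<open>The coefficients stabilize, so the diagonal is the limit of the
    iteration.\<close>
  define x where "x = Abs_fps (\<lambda>k. fps_nth (s k) k)"
  have x: "fps_nth x j = fps_nth (s k) j" if "j \<le> k" for j k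
    using stable[of j j "k - j"] that by (simp add: x_def)
  have "fps_nth (poly p x) k = 0" for k
  proof -
    obtain r where r: "poly p (s k + (x - s k)) = poly p (s k) + (x - s k) * poly (pderiv p) (s k) + (x - s k) * (x - s k) * r"
      using poly_taylor2 by blast
    have d: "fps_low (Suc k) (x - s k)" using x by (simp add: fps_low_def)
    have "fps_low (Suc k) ((x - s k) * (poly (pderiv p) (s k) + (x - s k) * r))"
      using fps_low_mult[OF d fps_low_0] by simp
    moreover have "poly p x = poly p (s k) + (x - s k) * (poly (pderiv p) (s k) + (x - s k) * r)"
      using r by (simp add: algebra_simps)
    ultimately have "fps_low (Suc k) (poly p x)"
      using fps_low_add nth0 by metis
    then show ?thesis by (simp add: fps_low_def)
  qed
  then have "poly p x = 0" by (simp add: fps_eq_iff)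
  moreover have "fps_nth x 0 = c" using nth0[of 0] by (simp add: x_def)
  ultimately show ?thesis by blast
qed

lemma map_poly_pderiv:
  fixes p :: "'a::idom poly" and f :: "'a \<Rightarrow> 'b::idom"
  assumes "rhom f"
  shows "map_poly f (pderiv p) = pderiv (map_poly f p)"
proof (rule poly_eqI)
  interpret rhom f by fact
  fix k show "coeff (map_poly f (pderiv p)) k = coeff (pderiv (map_poly f p)) k"
    using hom_of_nat[of "Suc k"] by (simp add: coeff_map_poly hom_zero coeff_pderiv hom_mult)
qed

section \<open>Reduction modulo the ideal\<close>

lemma is_ideal_ideal_gen: "is_ideal (ideal_gen A)"
  by (auto simp: ideal_gen_def is_ideal_def)

lemma is_ideal_add: "is_ideal J \<Longrightarrow> x \<in> J \<Longrightarrow> y \<in> J \<Longrightarrow> x + y \<in> J"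
  and is_ideal_mult: "is_ideal J \<Longrightarrow> x \<in> J \<Longrightarrow> r * x \<in> J"
  and is_ideal_0: "is_ideal J \<Longrightarrow> 0 \<in> J"
  by (simp_all add: is_ideal_def)

lemma ideal_gen_superset: "A \<subseteq> ideal_gen A"
  by (auto simp: ideal_gen_def)

lemma ideal_gen_minimal: "is_ideal J \<Longrightarrow> A \<subseteq> J \<Longrightarrow> ideal_gen A \<subseteq> J"
  by (auto simp: ideal_gen_def)

lemma is_ideal_kernel: "rhom f \<Longrightarrow> is_ideal {x. f x = 0}"
  by (simp add: is_ideal_def rhom.hom_zero rhom.hom_add rhom.hom_mult)

lemma is_ideal_sum:
  "is_ideal J \<Longrightarrow> (\<And>i. i \<in> B \<Longrightarrow> g i \<in> J) \<Longrightarrow> sum g B \<in> J"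
  by (induction B rule: infinite_finite_induct) (auto simp: is_ideal_def)

abbreviation (input) psum_ideal :: "nat \<Rightarrow> nat \<Rightarrow> 'n::finite cpoly set" where
  "psum_ideal a m \<equiv> ideal_gen {power_sum (k * a) | k. 1 \<le> k \<and> k \<le> m}"

lemma hsym_mem_psum_ideal:
  fixes A :: "'n::finite set"
  assumes "card (UNIV :: 'n set) - card A < k" "k \<le> m"
  shows "hsym k (\<lambda>i. var i ^ a) A \<in> psum_ideal a m"
proof (rule hsym_mem_ideal[OF is_ideal_ideal_gen _ _ assms])
  fix k :: nat assume k: "1 \<le> k"
  have "Const (1 / of_nat k) * of_nat k = (Const (1 / of_nat k * of_nat k) :: 'n cpoly)"
    by (simp only: rhom.hom_mult[OF rhom_Const] rhom.hom_of_nat[OF rhom_Const])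
  then show "\<exists>r :: 'n cpoly. r * of_nat k = 1"
    using k by (intro exI[of _ "Const (1 / of_nat k)"]) (simp add: rhom.hom_one[OF rhom_Const])
  assume "k \<le> m"
  with k show "(\<Sum>i\<in>UNIV. (var i ^ a) ^ k) \<in> (psum_ideal a m :: 'n cpoly set)"
    by (intro subsetD[OF ideal_gen_superset])
      (auto simp: power_sum_def mult.commute simp flip: power_mult intro!: exI[of _ k])
qed

lemma hsym_in_polys_in:
  "finite A \<Longrightarrow> A \<subseteq> B \<Longrightarrow> hsym k (\<lambda>i. var i ^ a) A \<in> polys_in B"
proof (induction A arbitrary: k rule: finite_induct)
  case empty
  then show ?case
    by (cases k) (simp_all add: hsym_def hfps_def polys_in_0 polys_in_1)
next
  case (insert x A)
  then show ?case
    by (auto simp: hsym_insert intro!: polys_in_sum polys_in_mult polys_in_power polys_in_var)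
qed

text \<open>Division with remainder by a polynomial in the ideal that is monic of degree \<open>d\<close> in \<open>var x\<close>.\<close>

lemma reduce_mod_monic:
  fixes J :: "'k cpoly set"
  assumes J: "is_ideal J" and d: "d \<ge> 1"
    and M: "M = {F. \<exists>G c. G \<in> J \<and> (\<forall>i<d. c i \<in> polys_in A) \<and> F = G + (\<Sum>i<d. c i * var x ^ i)}"
    and monic: "var x ^ d \<in> M" and F: "F \<in> polys_in (insert x A)"
  shows "F \<in> M"
proof -
  have J0: "0 \<in> J" and Jadd: "\<And>u v. u \<in> J \<Longrightarrow> v \<in> J \<Longrightarrow> u + v \<in> J"
    and Jmult: "\<And>r u. u \<in> J \<Longrightarrow> r * u \<in> J"
    using J by (auto simp: is_ideal_def)
  have M_add: "F + G \<in> M" if "F \<in> M" "G \<in> M" for F G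
  proof -
    from that obtain U c V e where "U \<in> J" "\<forall>i<d. c i \<in> polys_in A" "F = U + (\<Sum>i<d. c i * var x ^ i)"
      "V \<in> J" "\<forall>i<d. e i \<in> polys_in A" "G = V + (\<Sum>i<d. e i * var x ^ i)"
      unfolding M by blast
    then show ?thesis unfolding M
      by (intro CollectI exI[of _ "U + V"] exI[of _ "\<lambda>i. c i + e i"])
        (simp add: Jadd polys_in.add algebra_simps sum.distrib)
  qed
  have M_J: "F \<in> M" if "F \<in> J" for F
    unfolding M using that by (intro CollectI exI[of _ F] exI[of _ "\<lambda>_. 0"]) (simp add: polys_in_0)
  have M_sum: "sum g B \<in> M" if "\<And>i. i \<in> B \<Longrightarrow> g i \<in> M" for g and B :: "nat set"
    using that by (induction B rule: infinite_finite_induct) (auto simp: M_add M_J[OF J0])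
  have M_mono: "c * var x ^ i \<in> M" if "i < d" "c \<in> polys_in A" for c i
    unfolding M using that J0
    by (intro CollectI exI[of _ 0] exI[of _ "\<lambda>j. if j = i then c else 0"])
      (auto simp: polys_in_0 if_distrib[of "\<lambda>t. t * _"] cong: if_cong)
  have M_mult: "p * F \<in> M" if "p \<in> polys_in A" "F \<in> M" for p F
  proof -
    from that obtain U c where "U \<in> J" "\<forall>i<d. c i \<in> polys_in A" "F = U + (\<Sum>i<d. c i * var x ^ i)"
      unfolding M by blast
    with that show ?thesis unfolding M
      by (intro CollectI exI[of _ "p * U"] exI[of _ "\<lambda>i. p * c i"])
        (simp add: Jmult polys_in_mult distrib_left mult.assoc sum_distrib_left)
  qed
  have M_var: "var x * F \<in> M" if "F \<in> M" for F
  proof -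
    from that obtain U c where U: "U \<in> J" "\<forall>i<d. c i \<in> polys_in A" "F = U + (\<Sum>i<d. c i * var x ^ i)"
      unfolding M by blast
    \<comment> \<open>Only the top exponent \<open>i = d - 1\<close> leaves the allowed range, and
      there \<open>monic\<close> applies.\<close>
    have "c i * var x ^ Suc i \<in> M" if "i < d" for i
      using that U(2) monic by (cases "Suc i = d") (auto intro: M_mult M_mono simp del: power_Suc)
    then have "var x * U + (\<Sum>i<d. c i * var x ^ Suc i) \<in> M"
      by (intro M_add[OF M_J[OF Jmult[OF U(1)]]] M_sum) (simp del: power_Suc)
    then show ?thesis
      by (simp add: U(3) algebra_simps sum_distrib_left)
  qed
  show ?thesis using F
  proof induction
    case (Const c)
    show ?case using M_mono[of 0 "Const c"] d by (simp add: polys_in.Const)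
  next
    case (add F G)
    then show ?case by (simp add: M_add)
  next
    case (var_mult F i)
    then show ?case using M_var M_mult[OF polys_in_var] by auto
  qed
qed

text \<open>With k = n - |A|, the ideal contains h_k over \<open>insert x A\<close>, which is monic
  of degree a * k = \<open>d\<close> in \<open>var x\<close> and has its other coefficients in
  \<open>polys_in A\<close>. Division by it gives the remainder.\<close>

lemma reduce_mod_psum_ideal:
  fixes A :: "'n::finite set"
  assumes "a \<ge> 1" "x \<notin> A" "card (UNIV :: 'n set) - card A \<le> m" "F \<in> polys_in (insert x A)"
  defines "d \<equiv> a * (card (UNIV :: 'n set) - card A)"
  obtains G c where "G \<in> psum_ideal a m" "\<And>i. i < d \<Longrightarrow> c i \<in> polys_in A"
    "F = G + (\<Sum>i<d. c i * var x ^ i)"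
proof -
  define k where "k = card (UNIV :: 'n set) - card A"
  define M where "M = {F. \<exists>G c. G \<in> psum_ideal a m \<and> (\<forall>i<d. c i \<in> polys_in A) \<and>
    F = G + (\<Sum>i<d. c i * var x ^ i)}"
  have "card (insert x A) \<le> card (UNIV :: 'n set)" by (intro card_mono) auto
  then have k: "1 \<le> k" "card (UNIV :: 'n set) - card (insert x A) < k" 
    using assms(2) by (auto simp: k_def)
  have d: "d = a * k" "d \<ge> 1" using assms(1) k by (simp_all add: d_def k_def)
  let ?h = "\<lambda>k B. hsym k (\<lambda>i. var i ^ a) B"
  have "?h k (insert x A) \<in> psum_ideal a m"
    using k(2) assms(3) by (intro hsym_mem_psum_ideal) (auto simp: k_def)
  moreover have "?h k (insert x A) = var x ^ d + (\<Sum>i<k. var x ^ (a * i) * ?h (k - i) A)"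
    using assms(2) by (simp add: hsym_insert hsym_0 d lessThan_Suc_atMost[symmetric] power_mult)
  ultimately have mem: "var x ^ d + (\<Sum>i<k. var x ^ (a * i) * ?h (k - i) A) \<in> psum_ideal a m" by simp
  \<comment> \<open>The negated lower coefficients of that polynomial. It involves only powers of
    \<open>var x ^ a\<close>, hence the value \<open>0\<close> when \<open>a\<close> does not divide
    \<open>j\<close>.\<close>
  define c where "c j = (if a dvd j then - ?h (k - j div a) A else 0)" for j
  have "(\<Sum>j<d. c j * var x ^ j) = (\<Sum>j\<in>(\<lambda>i. a * i) ` {..<k}. c j * var x ^ j)"
    using assms(1) by (intro sum.mono_neutral_right) (auto simp: d c_def elim!: dvdE)
  also have "\<dots> = (\<Sum>i<k. - (var x ^ (a * i) * ?h (k - i) A))"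
    using assms(1) by (subst sum.reindex) (auto simp: inj_on_def c_def mult.commute)
  finally have "var x ^ d = (var x ^ d + (\<Sum>i<k. var x ^ (a * i) * ?h (k - i) A)) + (\<Sum>j<d. c j * var x ^ j)"
    by (simp add: sum_negf)
  moreover have "\<forall>j<d. c j \<in> polys_in A"
    by (auto simp: c_def polys_in_0 intro!: polys_in_uminus hsym_in_polys_in)
  ultimately have "var x ^ d \<in> M" unfolding M_def using mem by blast
  from reduce_mod_monic[OF is_ideal_ideal_gen d(2) M_def this assms(4)]
  show thesis unfolding M_def using that by blast
qed

section \<open>Generic points near a base point\<close>

text \<open>Power series in the deformation parameter u over polynomials in the directions v. The
  linear order on the index type \<open>nat\<close> gives the monomials a compatible order and hence
  an integral domain.\<close>

type_synonym dom = "nat cpoly fps"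

definition scal :: "complex \<Rightarrow> dom" where
  "scal c = fps_const (Const c)"

lemma rhom_scal: "rhom scal"
  by unfold_locales
    (simp_all add: scal_def rhom.hom_add[OF rhom_Const] rhom.hom_mult[OF rhom_Const] rhom.hom_one[OF rhom_Const])

lemmas rhom_ev_scal = rhom_ev[OF rhom_scal]

lemma fps_nth_0_scal: "fps_nth (scal c) 0 = Const c"
  by (simp add: scal_def)

lemma prod_linear_eqI:
  fixes p :: "'a::idom poly"
  assumes "finite B" "inj_on y B" "\<And>i. i \<in> B \<Longrightarrow> poly p (y i) = 0"
    and "degree p \<le> card B" "coeff p (card B) = 1"
  shows "p = (\<Prod>i\<in>B. [:- y i, 1:])"
proof (rule poly_eqI_degree_lead_coeff[of _ "card B" _ "y ` B"])
  have "degree (\<Prod>i\<in>B. [:- y i, 1:]) = card B"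
    by (subst degree_prod_eq_sum_degree) auto
  moreover have "lead_coeff (\<Prod>i\<in>B. [:- y i, 1:]) = 1"
    by (simp add: lead_coeff_prod)
  ultimately show "coeff p (card B) = coeff (\<Prod>i\<in>B. [:- y i, 1:]) (card B)"
    using assms(5) by simp
  show "degree (\<Prod>i\<in>B. [:- y i, 1:]) \<le> card B" by (rule degree_prod_linear_le)
  fix z assume "z \<in> y ` B"
  then show "poly p z = poly (\<Prod>i\<in>B. [:- y i, 1:]) z"
    using assms(1,3) by (auto simp: poly_prod)
qed (use assms in \<open>simp_all add: card_image\<close>)

text \<open>At \<open>y i\<close> only the summand of the derivative that omits the factor of
  \<open>i\<close> survives.\<close>

lemma poly_pderiv_prod_linear_nonzero:
  fixes y :: "'i \<Rightarrow> 'a::idom"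
  assumes "finite B" "inj_on y B" "i \<in> B"
  shows "poly (pderiv (\<Prod>i\<in>B. [:- y i, 1:])) (y i) \<noteq> 0"
proof -
  let ?R = "\<Prod>j\<in>B - {i}. [:- y j, 1:]"
  have "(\<Prod>i\<in>B. [:- y i, 1:]) = [:- y i, 1:] * ?R" using assms by (simp add: prod.remove)
  then have "poly (pderiv (\<Prod>i\<in>B. [:- y i, 1:])) (y i) = poly ?R (y i)"
    by (simp only: pderiv_mult) (simp add: pderiv_pCons)
  also have "\<dots> \<noteq> 0" using assms by (auto simp: poly_prod inj_on_def)
  finally show ?thesis .
qed

text \<open>\<open>\<rho>\<close> is the base point, \<open>Fr\<close> the set of its n - m free
  coordinates, and \<open>ix\<close> names a direction for each coordinate. The last two conditions
  make the \<open>a\<close>-th powers of the dependent coordinates simple roots that stay simple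
  when \<open>a\<close>-th roots are taken.\<close>

locale point_data =
  fixes a m :: nat and \<rho> :: "'n::finite \<Rightarrow> complex" and Fr :: "'n set" and ix :: "'n \<Rightarrow> nat"
  assumes a: "a \<ge> 1" and card_Fr: "card Fr + m = card (UNIV :: 'n set)" and inj_ix: "inj ix"
    and psum: "\<And>k. 1 \<le> k \<Longrightarrow> k \<le> m \<Longrightarrow> (\<Sum>i\<in>UNIV. (\<rho> i ^ a) ^ k) = 0"
    and inj_\<rho>: "inj_on (\<lambda>i. \<rho> i ^ a) (- Fr)" and \<rho>_nz: "\<And>i. i \<notin> Fr \<Longrightarrow> \<rho> i \<noteq> 0"
begin

definition free :: "'n \<Rightarrow> dom" where
  "free i = scal (\<rho> i) + fps_X * fps_const (var (ix i))"

text \<open>This is h_m in the \<open>a\<close>-th powers of the free coordinates and one further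
  variable. On the variety it vanishes at the \<open>a\<close>-th power of every dependent
  coordinate, so its roots define the lift.\<close>

definition Q :: "dom poly" where
  "Q = (\<Sum>j\<le>m. monom (hsym (m - j) (\<lambda>i. free i ^ a) Fr) j)"

definition Q0 :: "complex poly" where
  "Q0 = (\<Sum>j\<le>m. monom (hsym (m - j) (\<lambda>i. \<rho> i ^ a) Fr) j)"

lemma card_compl_Fr: "card (- Fr) = m"
  using card_Fr by (simp add: Compl_eq_Diff_UNIV card_Diff_subset)

lemma coeff_Q: "coeff Q j = (if j \<le> m then hsym (m - j) (\<lambda>i. free i ^ a) Fr else 0)"
  by (simp add: Q_def coeff_sum coeff_monom)

lemma coeff_Q0: "coeff Q0 j = (if j \<le> m then hsym (m - j) (\<lambda>i. \<rho> i ^ a) Fr else 0)"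
  by (simp add: Q0_def coeff_sum coeff_monom)

text \<open>The value at \<open>\<rho> l ^ a\<close> is h_m over \<open>insert l Fr\<close>, which
  vanishes on the variety. So a monic polynomial of degree \<open>m\<close> has \<open>m\<close>
  known distinct roots.\<close>

lemma Q0_eq: "Q0 = (\<Prod>i\<in>- Fr. [:- (\<rho> i ^ a), 1:])"
proof (rule prod_linear_eqI)
  show "degree Q0 \<le> card (- Fr)" by (intro degree_le) (simp add: coeff_Q0 card_compl_Fr)
  show "coeff Q0 (card (- Fr)) = 1" by (simp add: coeff_Q0 card_compl_Fr hsym_0)
  fix l assume l: "l \<in> - Fr"
  then have m: "m \<ge> 1" using card_compl_Fr by (metis One_nat_def Suc_leI card_gt_0_iff empty_iff finite)
  \<comment> \<open>The zero ideal turns the membership lemma into an equation; the complement of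
    \<open>insert l Fr\<close> has m - 1 elements.\<close>
  have "hsym m (\<lambda>i. \<rho> i ^ a) (insert l Fr) \<in> {0}"
  proof (rule hsym_mem_ideal[where m = m])
    show "\<exists>r. r * of_nat k = (1 :: complex)" if "1 \<le> k" for k
      using that by (intro exI[of _ "1 / of_nat k"]) simp
  qed (use psum l card_Fr m in \<open>auto simp: is_ideal_def\<close>)
  then show "poly Q0 (\<rho> l ^ a) = 0"
    using l by (simp add: hsym_insert Q0_def poly_sum poly_monom mult.commute)
qed (use inj_\<rho> in auto)

lemma map_poly_Q: "map_poly (\<lambda>f. fps_nth f 0) Q = map_poly Const Q0"
proof (rule poly_eqI)
  fix j
  have "fps_nth (hsym k (\<lambda>i. free i ^ a) Fr) 0 = hsym k (\<lambda>i. fps_nth (free i ^ a) 0) Fr" for k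
    by (rule hom_hsym[OF rhom_fps_nth_0]) simp
  also have "\<dots> k = hsym k (\<lambda>i. Const (\<rho> i ^ a)) Fr" for k
    by (intro hsym_cong)
      (simp add: rhom.hom_power[OF rhom_fps_nth_0] rhom.hom_power[OF rhom_Const] free_def fps_nth_0_scal)
  also have "\<dots> k = Const (hsym k (\<lambda>i. \<rho> i ^ a) Fr)" for k
    by (rule hom_hsym[OF rhom_Const, symmetric]) simp
  finally show "coeff (map_poly (\<lambda>f. fps_nth f 0) Q) j = coeff (map_poly Const Q0) j"
    by (simp add: coeff_map_poly rhom.hom_zero[OF rhom_Const] coeff_Q coeff_Q0)
qed

lemma poly_Q_nth_0:
  assumes "fps_nth x 0 = Const w"
  shows "fps_nth (poly Q x) 0 = Const (poly Q0 w)"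
    and "fps_nth (poly (pderiv Q) x) 0 = Const (poly (pderiv Q0) w)"
  unfolding fps_nth_0_poly assms map_poly_pderiv[OF rhom_fps_nth_0] map_poly_Q
    map_poly_pderiv[OF rhom_Const, symmetric] rhom.hom_poly[OF rhom_Const] by simp_all

definition Qa :: "dom poly" where
  "Qa = pcompose Q (monom 1 a)"

lemma poly_Qa: "poly Qa x = poly Q (x ^ a)"
  by (simp add: Qa_def poly_pcompose poly_monom)

text \<open>By the chain rule the derivative has constant term Q0'(\<rho>_l^a) * a * \<rho>_l^(a-1),
  nonzero because the roots of \<open>Q0\<close> are distinct and \<open>\<rho> l\<close> is
  nonzero. Being a complex constant, it is invertible, as Hensel's lemma requires.\<close>

lemma Qa_simple_root:
  assumes l: "l \<notin> Fr" and x: "fps_nth x 0 = Const (\<rho> l)"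
  obtains \<delta> where "fps_nth (poly Qa x) 0 = 0" "fps_nth (poly (pderiv Qa) x) 0 = Const \<delta>" "\<delta> \<noteq> 0"
proof
  have xa: "fps_nth (x ^ a) 0 = Const (\<rho> l ^ a)"
    by (simp add: x rhom.hom_power[OF rhom_fps_nth_0] rhom.hom_power[OF rhom_Const])
  have "poly Q0 (\<rho> l ^ a) = 0" using l by (auto simp: Q0_eq poly_prod)
  then show "fps_nth (poly Qa x) 0 = 0"
    by (simp add: poly_Qa poly_Q_nth_0(1)[OF xa] rhom.hom_zero[OF rhom_Const])
  let ?\<delta> = "poly (pderiv Q0) (\<rho> l ^ a) * (of_nat a * \<rho> l ^ (a - 1))"
  show "fps_nth (poly (pderiv Qa) x) 0 = Const ?\<delta>"
    by (simp add: Qa_def pderiv_pcompose poly_pcompose poly_monom pderiv_monom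
        poly_Q_nth_0(2)[OF xa] rhom.hom_mult[OF rhom_Const] rhom.hom_power[OF rhom_Const]
        rhom.hom_of_nat[OF rhom_Const] rhom.hom_power[OF rhom_fps_nth_0] rhom.hom_of_nat[OF rhom_fps_nth_0] x)
  show "?\<delta> \<noteq> 0"
    using poly_pderiv_prod_linear_nonzero[OF _ inj_\<rho>, of l] l \<rho>_nz[OF l] a by (simp add: Q0_eq)
qed

lemma dependent_unique:
  assumes "l \<notin> Fr" "fps_nth x 0 = Const (\<rho> l)" "fps_nth x' 0 = Const (\<rho> l)"
    and "poly Q (x ^ a) = 0" "poly Q (x' ^ a) = 0"
  shows "x = x'"
proof -
  obtain \<delta> where "fps_nth (poly (pderiv Qa) x) 0 = Const \<delta>" "\<delta> \<noteq> 0"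
    using Qa_simple_root[OF assms(1,2)] .
  then show ?thesis
    using assms hensel_unique[of Qa x x'] Const_eq_iff[of \<delta> 0]
    by (auto simp: poly_Qa rhom.hom_zero[OF rhom_Const])
qed

lemma dependent_exists:
  assumes "l \<notin> Fr"
  shows "\<exists>x. poly Q (x ^ a) = 0 \<and> fps_nth x 0 = Const (\<rho> l)"
proof -
  obtain \<delta> where \<delta>: "fps_nth (poly Qa (fps_const (Const (\<rho> l)))) 0 = 0"
    "fps_nth (poly (pderiv Qa) (fps_const (Const (\<rho> l)))) 0 = Const \<delta>" "\<delta> \<noteq> 0"
    using Qa_simple_root[OF assms, of "fps_const (Const (\<rho> l))"] by auto
  have "Const (1 / \<delta>) * Const \<delta> = (Const (1 / \<delta> * \<delta>) :: nat cpoly)"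
    by (simp only: rhom.hom_mult[OF rhom_Const])
  then have "Const (1 / \<delta>) * Const \<delta> = (1 :: nat cpoly)"
    using \<delta>(3) by (simp add: rhom.hom_one[OF rhom_Const])
  then show ?thesis using hensel_exists[OF \<delta>(1), of "Const (1 / \<delta>)"] \<delta>(2) by (simp add: poly_Qa)
qed

definition \<xi> :: "'n \<Rightarrow> dom" where
  "\<xi> l = (if l \<in> Fr then free l else SOME x. poly Q (x ^ a) = 0 \<and> fps_nth x 0 = Const (\<rho> l))"

lemma \<xi>_free: "l \<in> Fr \<Longrightarrow> \<xi> l = free l"
  by (simp add: \<xi>_def)

lemma \<xi>_dependent: "l \<notin> Fr \<Longrightarrow> poly Q (\<xi> l ^ a) = 0"
  and \<xi>_nth_0: "fps_nth (\<xi> l) 0 = Const (\<rho> l)"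
  using someI_ex[OF dependent_exists[of l]]
  by (auto simp: \<xi>_def free_def fps_nth_0_scal)

lemma \<xi>_power_nth_0: "fps_nth (\<xi> l ^ k) 0 = Const (\<rho> l ^ k)"
  by (simp add: rhom.hom_power[OF rhom_fps_nth_0] \<xi>_nth_0 rhom.hom_power[OF rhom_Const])

text \<open>The \<open>\<xi> i ^ a\<close> with \<open>i\<close> dependent are distinct, since their
  constant terms are, so \<open>Q\<close> is the product of their linear factors. Its coefficients
  are the h_j over \<open>Fr\<close>; hence h_k over all coordinates vanishes, and with it the power
  sums.\<close>

lemma psum_\<xi>:
  assumes "1 \<le> k" "k \<le> m"
  shows "(\<Sum>i\<in>UNIV. (\<xi> i ^ a) ^ k) = 0"
proof -
  have "inj_on (\<lambda>i. \<xi> i ^ a) (- Fr)"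
  proof (rule inj_onI)
    fix i j assume "i \<in> - Fr" "j \<in> - Fr" "\<xi> i ^ a = \<xi> j ^ a"
    then have "Const (\<rho> i ^ a) = (Const (\<rho> j ^ a) :: nat cpoly)" by (metis \<xi>_power_nth_0)
    then show "i = j" using \<open>i \<in> - Fr\<close> \<open>j \<in> - Fr\<close> inj_\<rho> by (simp add: Const_eq_iff inj_on_def)
  qed
  then have Q: "Q = (\<Prod>i\<in>- Fr. [:- (\<xi> i ^ a), 1:])"
    by (intro prod_linear_eqI)
      (auto simp: \<xi>_dependent coeff_Q card_compl_Fr hsym_0 intro: degree_le)
  have "hsym k (\<lambda>i. \<xi> i ^ a) (Fr \<union> - Fr) = 0" if "1 \<le> k" "k \<le> m" for k
  proof (rule hsym_eq_0_if_coeffs_prod[where m = m])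
    fix j assume "j \<le> m"
    then have "coeff Q (card (- Fr) - j) = hsym j (\<lambda>i. free i ^ a) Fr"
      by (simp add: coeff_Q card_compl_Fr)
    also have "\<dots> = hsym j (\<lambda>i. \<xi> i ^ a) Fr" by (intro hsym_cong) (simp add: \<xi>_free)
    finally show "coeff (\<Prod>i\<in>- Fr. [:- (\<xi> i ^ a), 1:]) (card (- Fr) - j) = hsym j (\<lambda>i. \<xi> i ^ a) Fr"
      by (simp only: Q)
  qed (use that in \<open>auto simp: card_compl_Fr\<close>)
  then show ?thesis
    using assms by (intro power_sum_eq_0_if_hsym_eq_0[where m = m]) (simp_all add: Compl_partition)
qed

text \<open>The conjugates of \<open>\<xi>\<close> over the subring generated by the free coordinates.\<close>

definition V :: "('n \<Rightarrow> dom) set" where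
  "V = {\<lambda>i. scal (z i) * \<xi> (\<pi> i) | \<pi> z. \<pi> permutes (- Fr) \<and> (\<forall>i. z i ^ a = 1) \<and> (\<forall>i\<in>Fr. z i = 1)}"

lemma psum_V:
  assumes "\<zeta> \<in> V" "1 \<le> k" "k \<le> m"
  shows "(\<Sum>i\<in>UNIV. \<zeta> i ^ (k * a)) = 0"
proof -
  obtain \<pi> z where \<zeta>: "\<zeta> = (\<lambda>i. scal (z i) * \<xi> (\<pi> i))" "\<pi> permutes (- Fr)" "\<forall>i. z i ^ a = 1"
    using assms(1) unfolding V_def by blast
  have "\<zeta> i ^ (k * a) = (\<xi> (\<pi> i) ^ a) ^ k" for i
    using \<zeta>(3) by (simp add: \<zeta>(1) mult.commute[of k] power_mult power_mult_distrib
        rhom.hom_one[OF rhom_scal] flip: rhom.hom_power[OF rhom_scal])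
  then have "(\<Sum>i\<in>UNIV. \<zeta> i ^ (k * a)) = (\<Sum>i\<in>UNIV. (\<xi> (\<pi> i) ^ a) ^ k)" by simp
  also have "\<dots> = (\<Sum>i\<in>UNIV. (\<xi> i ^ a) ^ k)"
    using sum.permute[of \<pi> UNIV "\<lambda>i. (\<xi> i ^ a) ^ k"] permutes_subset[OF \<zeta>(2)] by (simp add: o_def)
  finally show ?thesis using psum_\<xi> assms by simp
qed

section \<open>The ideal as the set of polynomials vanishing on \<open>V\<close>\<close>

lemma psum_ideal_vanishes:
  assumes "\<zeta> \<in> V" "F \<in> psum_ideal a m"
  shows "ev scal \<zeta> F = 0"
proof -
  have "psum_ideal a m \<subseteq> {F. ev scal \<zeta> F = 0}"
    using psum_V[OF assms(1)]
    by (intro ideal_gen_minimal is_ideal_kernel rhom_ev_scal)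
      (auto simp: power_sum_def rhom.hom_sum[OF rhom_ev_scal] rhom.hom_power[OF rhom_ev_scal] ev_var rhom_scal)
  then show ?thesis using assms(2) by auto
qed

text \<open>The free coordinates are polynomials in u, so the evaluation takes place among
  polynomials, where u = 1 can be substituted. This gives F(\<rho> + v), and the translation
  \<open>\<theta>\<close> recovers \<open>F\<close>.\<close>

lemma free_independent:
  assumes F: "F \<in> polys_in Fr" and zero: "ev scal \<xi> F = 0"
  shows "F = 0"
proof -
  let ?c = "\<lambda>c. [:Const c:] :: nat cpoly poly" and ?p = "\<lambda>i. [:Const (\<rho> i), var (ix i):]"
  have c: "rhom ?c"
    by unfold_locales (simp_all add: rhom.hom_add[OF rhom_Const] rhom.hom_mult[OF rhom_Const]
        rhom.hom_one[OF rhom_Const] one_pCons)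
  have fps: "rhom (fps_of_poly :: nat cpoly poly \<Rightarrow> dom)"
    by unfold_locales (simp_all add: fps_of_poly_add fps_of_poly_mult)
  have "fps_of_poly (ev ?c ?p F) = ev scal \<xi> F"
    by (rule rhom_eq_on_polys_in[OF rhom_comp[OF fps rhom_ev[OF c]] rhom_ev_scal _ _ F])
      (simp_all add: ev_Const ev_var c rhom_scal scal_def \<xi>_free free_def fps_of_poly_pCons fps_of_poly_const)
  then have "fps_of_poly (ev ?c ?p F) = fps_of_poly 0" using zero by simp
  then have P: "ev ?c ?p F = 0" by (simp only: fps_of_poly_eq_iff)
  have ev1: "rhom (\<lambda>p :: nat cpoly poly. poly p 1)" by unfold_locales simp_all
  define \<theta> :: "nat cpoly \<Rightarrow> 'n cpoly"
    where "\<theta> = ev Const (\<lambda>k. var (inv ix k) - Const (\<rho> (inv ix k)))"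
  have \<theta>: "rhom \<theta>" unfolding \<theta>_def by (rule rhom_ev[OF rhom_Const])
  have "poly (ev ?c ?p F) 1 = ev Const (\<lambda>i. Const (\<rho> i) + var (ix i)) F"
    using rhom_ev_comp[OF ev1 c, of ?p F] by simp
  moreover have "\<theta> (ev Const (\<lambda>i. Const (\<rho> i) + var (ix i)) F) = ev Const var F"
    unfolding rhom_ev_comp[OF \<theta> rhom_Const] rhom.hom_add[OF \<theta>]
    by (simp add: \<theta>_def ev_Const ev_var rhom_Const inv_f_f[OF inj_ix])
  moreover have "ev Const var F = F"
    by (rule rhom_eq_on_polys_in[OF rhom_ev[OF rhom_Const] rhom_id _ _ polys_in_UNIV])
      (simp_all add: ev_Const ev_var rhom_Const)
  ultimately have "F = \<theta> (poly (ev ?c ?p F) 1)" by simp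
  then show ?thesis using P by (simp add: rhom.hom_zero[OF \<theta>])
qed

lemma \<xi>_in_V: "\<xi> \<in> V"
  unfolding V_def
  by (intro CollectI exI[of _ id] exI[of _ "\<lambda>_. 1"]) (simp add: permutes_id rhom.hom_one[OF rhom_scal])

text \<open>With the coordinates in \<open>A\<close> held fixed, coordinate \<open>x\<close> can be
  moved to any remaining conjugate: swap \<open>x\<close> with \<open>j\<close> and replace the
  scalar at \<open>x\<close>.\<close>

lemma V_change:
  assumes "\<zeta> = (\<lambda>i. scal (z i) * \<xi> (\<pi> i))" "\<pi> permutes (- Fr)" "\<forall>i. z i ^ a = 1" "\<forall>i\<in>Fr. z i = 1"
    and "Fr \<subseteq> A" "x \<notin> A" "j \<notin> A" "w ^ a = 1"
  obtains \<zeta>' where "\<zeta>' \<in> V" "\<And>i. i \<in> A \<Longrightarrow> \<zeta>' i = \<zeta> i" "\<zeta>' x = scal w * \<xi> (\<pi> j)"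
proof
  let ?z = "z(x := w)" and ?\<pi> = "\<pi> \<circ> transpose x j"
  have "?\<pi> permutes - Fr" using assms by (intro permutes_compose permutes_swap_id) auto
  then show "(\<lambda>i. scal (?z i) * \<xi> (?\<pi> i)) \<in> V"
    unfolding V_def using assms by (intro CollectI exI[of _ ?\<pi>] exI[of _ ?z]) auto
  show "scal (?z i) * \<xi> (?\<pi> i) = \<zeta> i" if "i \<in> A" for i
  proof -
    have "i \<noteq> x" "i \<noteq> j" using that assms by auto
    then show ?thesis by (simp add: assms(1))
  qed
qed simp

text \<open>Constant terms tell the conjugates apart: their \<open>a\<close>-th powers determine
  \<open>j\<close>, and then \<open>w\<close> follows since \<open>\<rho>\<close> is nonzero off
  \<open>Fr\<close>. The count matches the degree bound in
  \<open>reduce_mod_psum_ideal\<close>.\<close>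

lemma card_conjugates:
  assumes "\<pi> permutes (- Fr)" "Fr \<subseteq> A"
  shows "card ((\<lambda>(j, w). scal w * \<xi> (\<pi> j)) ` ((- A) \<times> {w. w ^ a = 1})) = a * (card (UNIV :: 'n set) - card A)"
proof -
  have "inj_on (\<lambda>(j, w). scal w * \<xi> (\<pi> j)) ((- A) \<times> {w. w ^ a = 1})"
  proof (rule inj_onI, clarsimp)
    fix j w j' w' assume *: "j \<notin> A" "j' \<notin> A" "w ^ a = 1" "w' ^ a = 1"
      and eq: "scal w * \<xi> (\<pi> j) = scal w' * \<xi> (\<pi> j')"
    have nin: "\<pi> j \<in> - Fr" "\<pi> j' \<in> - Fr" using * assms permutes_in_image[OF assms(1)] by auto
    from eq have "fps_nth (scal w * \<xi> (\<pi> j)) 0 = fps_nth (scal w' * \<xi> (\<pi> j')) 0" by (simp only:)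
    then have "(Const (w * \<rho> (\<pi> j)) :: nat cpoly) = Const (w' * \<rho> (\<pi> j'))"
      by (simp add: fps_nth_0_scal \<xi>_nth_0 rhom.hom_mult[OF rhom_Const])
    then have e: "w * \<rho> (\<pi> j) = w' * \<rho> (\<pi> j')" by (simp only: Const_eq_iff)
    then have "(w * \<rho> (\<pi> j)) ^ a = (w' * \<rho> (\<pi> j')) ^ a" by simp
    then have "\<rho> (\<pi> j) ^ a = \<rho> (\<pi> j') ^ a" using * by (simp add: power_mult_distrib)
    then have "\<pi> j = \<pi> j'" using inj_\<rho> nin by (simp add: inj_on_def)
    then show "j = j' \<and> w = w'"
      using e \<rho>_nz[of "\<pi> j'"] nin permutes_inj[OF assms(1)] by (auto simp: inj_def)
  qed
  then have "card ((\<lambda>(j, w). scal w * \<xi> (\<pi> j)) ` ((- A) \<times> {w. w ^ a = 1})) = card (- A) * card {w::complex. w ^ a = 1}"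
    by (simp add: card_image card_cartesian_product)
  then show ?thesis
    using a card_roots_unity_eq[of a] by (simp add: Compl_eq_Diff_UNIV card_Diff_subset)
qed

text \<open>Dependent variables are added to \<open>Fr\<close> one by one. Reduction leaves degree
  below \<open>d\<close> in the new variable, while \<open>V\<close> offers \<open>d\<close> values
  for it over each choice of the others; so the coefficients vanish on \<open>V\<close> and lie in
  the ideal by induction.\<close>

lemma vanishing_imp_mem:
  assumes "\<And>\<zeta>. \<zeta> \<in> V \<Longrightarrow> ev scal \<zeta> F = 0"
  shows "F \<in> psum_ideal a m"
proof -
  have "F \<in> psum_ideal a m"
    if "B \<subseteq> - Fr" "F \<in> polys_in (Fr \<union> B)" "\<And>\<zeta>. \<zeta> \<in> V \<Longrightarrow> ev scal \<zeta> F = 0" for F B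
    using finite[of B] that
  proof (induction B arbitrary: F rule: finite_induct)
    case empty
    then have "F = 0" using free_independent \<xi>_in_V by simp
    then show ?case using is_ideal_0[OF is_ideal_ideal_gen] by simp
  next
    case (insert x B)
    let ?A = "Fr \<union> B"
    define d where "d = a * (card (UNIV :: 'n set) - card ?A)"
    have x: "x \<notin> ?A" using insert by auto
    have "card Fr \<le> card ?A" by (intro card_mono) auto
    then have "card (UNIV :: 'n set) - card ?A \<le> m" using card_Fr by linarith
    moreover have "F \<in> polys_in (insert x ?A)" using insert.prems by simp
    ultimately obtain G c where G: "G \<in> psum_ideal a m" and c: "\<And>i. i < d \<Longrightarrow> c i \<in> polys_in ?A"
      and F: "F = G + (\<Sum>i<d. c i * var x ^ i)"
      using reduce_mod_psum_ideal[OF a x, of m F] unfolding d_def by blast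
    have "ev scal \<zeta> (c i) = 0" if \<zeta>: "\<zeta> \<in> V" and i: "i < d" for \<zeta> i
    proof -
      obtain \<pi> z where \<pi>z: "\<zeta> = (\<lambda>i. scal (z i) * \<xi> (\<pi> i))" "\<pi> permutes (- Fr)"
        "\<forall>i. z i ^ a = 1" "\<forall>i\<in>Fr. z i = 1"
        using \<zeta> unfolding V_def by blast
      \<comment> \<open>\<open>p\<close> is the remainder as a polynomial in \<open>x\<close>, with
        coefficients evaluated at \<open>\<zeta>\<close>. \<open>R\<close> consists of
        \<open>d\<close> values attained by coordinate \<open>x\<close> at points of
        \<open>V\<close> that agree with \<open>\<zeta>\<close> on \<open>?A\<close>.\<close>
      define p where "p = (\<Sum>i<d. monom (ev scal \<zeta> (c i)) i)"
      define R where "R = (\<lambda>(j, w). scal w * \<xi> (\<pi> j)) ` ((- ?A) \<times> {w. w ^ a = 1})"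
      have coeff_p: "coeff p k = (if k < d then ev scal \<zeta> (c k) else 0)" for k
        by (simp add: p_def coeff_sum coeff_monom)
      have "p = 0"
      proof (rule poly_eqI_degree[of R])
        have R: "card R = d" unfolding R_def d_def by (rule card_conjugates[OF \<pi>z(2)]) simp
        have "degree p \<le> d - 1" by (intro degree_le) (auto simp: coeff_p)
        then show "degree p < card R" "degree (0 :: dom poly) < card R" using R i by auto
        fix r assume "r \<in> R"
        then obtain j w where jw: "j \<notin> ?A" "w ^ a = 1" "r = scal w * \<xi> (\<pi> j)" by (auto simp: R_def)
        obtain \<zeta>' where \<zeta>': "\<zeta>' \<in> V" "\<And>i. i \<in> ?A \<Longrightarrow> \<zeta>' i = \<zeta> i" "\<zeta>' x = r"
          using V_change[OF \<pi>z _ x jw(1,2)] jw(3) by blast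
        have "ev scal \<zeta>' (c k) = ev scal \<zeta> (c k)" if "k < d" for k
          by (rule rhom_eq_on_polys_in[OF rhom_ev_scal rhom_ev_scal _ _ c[OF that]])
            (simp_all add: ev_Const[OF rhom_scal] ev_var[OF rhom_scal] \<zeta>'(2))
        then have "poly p r = (\<Sum>i<d. ev scal \<zeta>' (c i) * \<zeta>' x ^ i)"
          by (simp add: p_def poly_sum poly_monom \<zeta>'(3))
        also have "\<dots> = ev scal \<zeta>' F"
          by (simp add: F rhom.hom_add[OF rhom_ev_scal] rhom.hom_sum[OF rhom_ev_scal]
              rhom.hom_mult[OF rhom_ev_scal] rhom.hom_power[OF rhom_ev_scal] ev_var[OF rhom_scal]
              psum_ideal_vanishes[OF \<zeta>'(1) G])
        finally show "poly p r = poly 0 r" using insert.prems(3)[OF \<zeta>'(1)] by simp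
      qed
      then show ?thesis using coeff_p[of i] i by simp
    qed
    then have "c i \<in> psum_ideal a m" if "i < d" for i
      using insert.IH[of "c i"] insert.prems(1) c that by auto
    then have "c i * var x ^ i \<in> psum_ideal a m" if "i < d" for i
      using is_ideal_mult[OF is_ideal_ideal_gen, of "c i" _ "var x ^ i"] that by (simp add: mult.commute)
    then have "(\<Sum>i<d. c i * var x ^ i) \<in> psum_ideal a m"
      by (intro is_ideal_sum[OF is_ideal_ideal_gen]) simp
    then show ?case
      unfolding F by (rule is_ideal_add[OF is_ideal_ideal_gen G])
  qed
  from this[OF subset_refl _ assms] show ?thesis using polys_in_UNIV[of F] by (simp add: Compl_partition)
qed

end

section \<open>The monomial group\<close>

definition act :: "('n \<Rightarrow> 'n) \<Rightarrow> ('n \<Rightarrow> complex) \<Rightarrow> 'n cpoly \<Rightarrow> 'n cpoly" where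
  "act \<pi> z = ev Const (\<lambda>i. Const (z i) * var (\<pi> i))"

lemma rhom_act: "rhom (act \<pi> z)"
  unfolding act_def by (rule rhom_ev[OF rhom_Const])

lemma act_var: "act \<pi> z (var i) = Const (z i) * var (\<pi> i)"
  by (simp add: act_def ev_var rhom_Const)

lemma act_Const: "act \<pi> z (Const c) = Const c"
  by (simp add: act_def ev_Const rhom_Const)

lemma act_act: "act \<pi> z (act \<pi>' z' F) = act (\<pi> \<circ> \<pi>') (\<lambda>i. z' i * z (\<pi>' i)) F"
  by (rule rhom_eq_on_polys_in[OF rhom_comp[OF rhom_act rhom_act] rhom_act _ _ polys_in_UNIV])
    (simp_all add: act_Const act_var rhom.hom_mult[OF rhom_act] rhom.hom_mult[OF rhom_Const] mult.assoc)

lemma act_id: "act id (\<lambda>_. 1) F = F"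
  by (rule rhom_eq_on_polys_in[OF rhom_act rhom_id _ _ polys_in_UNIV])
    (simp_all add: act_Const act_var rhom.hom_one[OF rhom_Const])

text \<open>Moves a group element from the polynomial to the point. In this way every element of
  \<open>V\<close> arises from \<open>\<xi>\<close>.\<close>

lemma ev_scal_act: "ev scal \<zeta> (act \<pi> z F) = ev scal (\<lambda>i. scal (z i) * \<zeta> (\<pi> i)) F"
  by (rule rhom_eq_on_polys_in[OF rhom_comp[OF rhom_ev_scal rhom_act] rhom_ev_scal _ _ polys_in_UNIV])
    (simp_all add: act_Const act_var ev_Const[OF rhom_scal] ev_var[OF rhom_scal] rhom.hom_mult[OF rhom_ev_scal])

lemma rhom_fps_map: "rhom f \<Longrightarrow> rhom (\<lambda>x. Abs_fps (\<lambda>k. f (fps_nth x k)))"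
  by unfold_locales
    (simp_all add: fps_eq_iff rhom.hom_add rhom.hom_one rhom.hom_zero rhom.hom_mult fps_mult_nth rhom.hom_sum)

context point_data
begin

text \<open>If \<open>act \<tau> s\<close> fixes \<open>\<rho>\<close>, it is induced on every conjugate of \<open>\<xi>\<close> by an automorphism \<open>\<sigma>\<close> of the
  target domain: by uniqueness in Hensel's lemma \<open>\<sigma>\<close> fixes the dependent coordinates.\<close>

lemma mirror_stable:
  assumes \<tau>: "\<tau> permutes Fr" and s: "\<And>i. s i ^ a = 1" "\<And>i. i \<notin> Fr \<Longrightarrow> s i = 1"
    and \<rho>: "\<And>i. i \<in> Fr \<Longrightarrow> \<rho> i = s i * \<rho> (\<tau> i)"
    and fg: "f * g \<in> psum_ideal a m"
  shows "f * act \<tau> s g \<in> psum_ideal a m"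
proof (rule vanishing_imp_mem)
  \<comment> \<open>The same monomial substitution on the directions, with \<open>inv ix\<close>
    recovering a coordinate from its name. By the mirror condition on \<open>\<rho>\<close>, its
    extension \<open>\<sigma>\<close> sends \<open>free i\<close> to \<open>s i\<close> times
    \<open>free (\<tau> i)\<close>.\<close>
  define \<sigma>0 :: "nat cpoly \<Rightarrow> nat cpoly"
    where "\<sigma>0 = ev Const (\<lambda>k. Const (s (inv ix k)) * var (ix (\<tau> (inv ix k))))"
  define \<sigma> :: "dom \<Rightarrow> dom" where "\<sigma> x = Abs_fps (\<lambda>k. \<sigma>0 (fps_nth x k))" for x
  have \<sigma>0: "rhom \<sigma>0" unfolding \<sigma>0_def by (rule rhom_ev[OF rhom_Const])
  have \<sigma>: "rhom \<sigma>" unfolding \<sigma>_def by (rule rhom_fps_map[OF \<sigma>0])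
  have \<sigma>0_Const: "\<sigma>0 (Const c) = Const c" for c by (simp add: \<sigma>0_def ev_Const rhom_Const)
  have \<sigma>_const: "\<sigma> (fps_const b) = fps_const (\<sigma>0 b)" for b
    by (simp add: \<sigma>_def fps_eq_iff rhom.hom_zero[OF \<sigma>0])
  have \<sigma>_scal: "\<sigma> (scal c) = scal c" for c by (simp add: scal_def \<sigma>_const \<sigma>0_Const)
  have \<sigma>_X: "\<sigma> fps_X = fps_X"
    by (simp add: \<sigma>_def fps_eq_iff rhom.hom_zero[OF \<sigma>0] rhom.hom_one[OF \<sigma>0])
  have \<sigma>0_var: "\<sigma>0 (var (ix i)) = Const (s i) * var (ix (\<tau> i))" for i
    by (simp add: \<sigma>0_def ev_var rhom_Const inv_f_f[OF inj_ix])
  have \<sigma>_free: "\<sigma> (free i) = scal (s i) * free (\<tau> i)" if "i \<in> Fr" for i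
  proof -
    have "\<sigma> (free i) = scal (\<rho> i) + fps_X * fps_const (Const (s i) * var (ix (\<tau> i)))"
      by (simp add: free_def rhom.hom_add[OF \<sigma>] rhom.hom_mult[OF \<sigma>] \<sigma>_scal \<sigma>_X \<sigma>_const \<sigma>0_var)
    also have "\<dots> = scal (s i) * scal (\<rho> (\<tau> i)) + fps_X * (scal (s i) * fps_const (var (ix (\<tau> i))))"
      unfolding \<rho>[OF that] by (simp add: rhom.hom_mult[OF rhom_scal]) (simp add: scal_def)
    finally show ?thesis by (simp add: free_def algebra_simps)
  qed
  \<comment> \<open>Since \<open>s i ^ a = 1\<close>, the \<open>a\<close>-th powers of the free
    coordinates are merely permuted, and h_k is symmetric.\<close>
  have "\<sigma> (hsym k (\<lambda>i. free i ^ a) Fr) = hsym k (\<lambda>i. free i ^ a) Fr" for k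
  proof -
    have "\<sigma> (hsym k (\<lambda>i. free i ^ a) Fr) = hsym k (\<lambda>i. \<sigma> (free i ^ a)) Fr"
      by (rule hom_hsym[OF \<sigma>]) simp
    also have "\<dots> = hsym k (\<lambda>i. free (\<tau> i) ^ a) Fr"
      by (intro hsym_cong)
        (simp add: rhom.hom_power[OF \<sigma>] \<sigma>_free power_mult_distrib s(1)
          rhom.hom_one[OF rhom_scal] flip: rhom.hom_power[OF rhom_scal])
    also have "\<dots> = hsym k (\<lambda>i. free i ^ a) Fr" by (rule hsym_permutes[OF \<tau>])
    finally show ?thesis .
  qed
  then have map_Q: "map_poly \<sigma> Q = Q"
    by (intro poly_eqI) (simp add: coeff_map_poly rhom.hom_zero[OF \<sigma>] coeff_Q)
  have \<sigma>_dep: "\<sigma> (\<xi> l) = \<xi> l" if "l \<notin> Fr" for l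
  proof (rule dependent_unique[OF that])
    show "fps_nth (\<sigma> (\<xi> l)) 0 = Const (\<rho> l)" by (simp add: \<sigma>_def \<xi>_nth_0 \<sigma>0_Const)
    have "poly Q (\<sigma> (\<xi> l) ^ a) = \<sigma> (poly Q (\<xi> l ^ a))"
      by (simp add: rhom.hom_poly[OF \<sigma>] map_Q rhom.hom_power[OF \<sigma>])
    then show "poly Q (\<sigma> (\<xi> l) ^ a) = 0" by (simp add: \<xi>_dependent[OF that] rhom.hom_zero[OF \<sigma>])
  qed (use \<xi>_nth_0 \<xi>_dependent[OF that] in auto)
  fix \<zeta> assume \<zeta>V: "\<zeta> \<in> V"
  then obtain \<pi> z where \<zeta>: "\<zeta> = (\<lambda>i. scal (z i) * \<xi> (\<pi> i))" "\<pi> permutes (- Fr)" "\<forall>i\<in>Fr. z i = 1"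
    unfolding V_def by blast
  have \<zeta>_free: "\<zeta> i = free i" if "i \<in> Fr" for i
    using that \<zeta>(3) permutes_not_in[OF \<zeta>(2), of i] by (simp add: \<zeta>(1) rhom.hom_one[OF rhom_scal] \<xi>_free)
  have coord: "scal (s i) * \<zeta> (\<tau> i) = \<sigma> (\<zeta> i)" for i
  proof (cases "i \<in> Fr")
    case True
    then show ?thesis using permutes_in_image[OF \<tau>] by (simp add: \<zeta>_free \<sigma>_free)
  next
    case False
    then have "\<pi> i \<notin> Fr" using permutes_in_image[OF \<zeta>(2), of i] by auto
    then show ?thesis
      using False permutes_not_in[OF \<tau> False] s(2)[OF False]
      by (simp add: \<zeta>(1) rhom.hom_one[OF rhom_scal] rhom.hom_mult[OF \<sigma>] \<sigma>_scal \<sigma>_dep)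
  qed
  \<comment> \<open>Acting on \<open>g\<close> applies \<open>\<sigma>\<close> to its value at
    \<open>\<zeta>\<close>, so a zero value stays zero.\<close>
  have "ev scal \<zeta> (act \<tau> s g) = \<sigma> (ev scal \<zeta> g)"
    unfolding ev_scal_act coord rhom_ev_comp[OF \<sigma> rhom_scal] \<sigma>_scal by simp
  moreover have "ev scal \<zeta> f * ev scal \<zeta> g = 0"
    using psum_ideal_vanishes[OF \<zeta>V fg] by (simp add: rhom.hom_mult[OF rhom_ev_scal])
  ultimately show "ev scal \<zeta> (f * act \<tau> s g) = 0"
    by (auto simp: rhom.hom_mult[OF rhom_ev_scal] rhom.hom_zero[OF \<sigma>])
qed

end

section \<open>Base points on the mirrors\<close>

text \<open>The coefficients in degrees n - 1 down to 2 vanish, which is the coefficient criterion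
  with \<open>A\<close> empty.\<close>

lemma psum_eq_0_if_trinomial:
  fixes y :: "'n::finite \<Rightarrow> complex"
  assumes prod: "(\<Prod>i\<in>UNIV. [:- y i, 1:]) = monom 1 (card (UNIV :: 'n set)) + [:c, b:]"
    and n: "card (UNIV :: 'n set) \<ge> 2" and k: "1 \<le> k" "k \<le> card (UNIV :: 'n set) - 2"
  shows "(\<Sum>i\<in>UNIV. y i ^ k) = 0"
proof -
  let ?n = "card (UNIV :: 'n set)"
  have "hsym k y ({} \<union> UNIV) = 0" if "1 \<le> k" "k \<le> ?n - 2" for k
  proof (rule hsym_eq_0_if_coeffs_prod[where m = "?n - 2"])
    fix i assume i: "i \<le> ?n - 2"
    then have "?n - i \<ge> 2" using n by linarith
    then obtain l where "?n - i = Suc (Suc l)" by (metis add_2_eq_Suc le_Suc_ex)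
    moreover have "?n = ?n - i \<longleftrightarrow> i = 0" using n i by linarith
    ultimately show "coeff (\<Prod>i\<in>UNIV. [:- y i, 1:]) (?n - i) = hsym i y {}"
      using coeff_pCons_Suc[of c "[:b:]"] by (simp add: prod coeff_monom hsym_def hfps_def)
  qed (use that in auto)
  then show ?thesis
    using k by (intro power_sum_eq_0_if_hsym_eq_0[where m = "?n - 2"]) simp_all
qed

text \<open>T^n - n T + (n - 1) has 1 as a double root, which serves \<open>i\<close> and
  \<open>j\<close>, and n - 2 further roots, simple and nonzero, for the other indices.\<close>

lemma swap_base_point:
  fixes i j :: "'n::finite"
  assumes n: "card (UNIV :: 'n set) \<ge> 3" and ij: "i \<noteq> j"
  obtains y :: "'n \<Rightarrow> complex" where "y i = 1" "y j = 1" "inj_on y (- {i})" "\<And>l. y l \<noteq> 0"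
    "\<And>k. 1 \<le> k \<Longrightarrow> k \<le> card (UNIV :: 'n set) - 2 \<Longrightarrow> (\<Sum>i\<in>UNIV. y i ^ k) = 0"
proof -
  define n where "n = card (UNIV :: 'n set)"
  have n3: "n \<ge> 3" using n by (simp add: n_def)
  define p :: "complex poly" where "p = monom 1 n + [:of_nat n - 1, - of_nat n:]"
  have p': "pderiv p = monom (of_nat n) (n - 1) + [:- of_nat n:]"
    by (simp add: p_def pderiv_add pderiv_monom pderiv_pCons)
  have p'': "pderiv (pderiv p) = monom (of_nat n * of_nat (n - 1)) (n - 2)"
    by (simp add: p' pderiv_add pderiv_monom pderiv_pCons numeral_2_eq_2 mult.commute)
  have deg_p: "degree p = n"
    unfolding p_def using n3 by (subst degree_add_eq_left) (simp_all add: degree_monom_eq)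
  have lead_p: "coeff p n = 1"
    using n3 by (cases n) (auto simp: p_def coeff_pCons split: nat.splits)
  have "poly p 1 = 0" by (simp add: p_def poly_monom)
  then obtain q where q: "p = [:-1, 1:] * q" by (metis poly_eq_0_iff_dvd dvdE)
  have "poly (pderiv p) 1 = poly q 1" unfolding q pderiv_mult by (simp add: pderiv_pCons)
  then have "poly q 1 = 0" by (simp add: p' poly_monom)
  then obtain g where g: "q = [:-1, 1:] * g" by (metis poly_eq_0_iff_dvd dvdE)
  have p_eq: "p = [:-1, 1:] * ([:-1, 1:] * g)" by (simp only: q g)
  \<comment> \<open>A nonzero second derivative shows that the root 1 is exactly double.\<close>
  have "poly (pderiv (pderiv p)) 1 = 2 * poly g 1"
    unfolding p_eq pderiv_mult pderiv_add by (simp add: pderiv_pCons)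
  then have g1: "poly g 1 \<noteq> 0" using n3 by (auto simp: p'' poly_monom)
  have g_ne: "g \<noteq> 0" using g1 by auto
  have deg_linear: "degree ([:-1, 1:] * r) = Suc (degree r)" if "r \<noteq> 0" for r :: "complex poly"
    using that by (subst degree_mult_eq) auto
  have nz: "[:-1, 1:] * g \<noteq> 0" using g_ne by (simp only: mult_eq_0_iff) simp
  have "degree p = Suc (Suc (degree g))" unfolding p_eq deg_linear[OF nz] deg_linear[OF g_ne] ..
  then have deg_g: "degree g = n - 2" using deg_p by simp
  have "lead_coeff p = lead_coeff g" unfolding p_eq lead_coeff_mult by simp
  then have lead_g: "lead_coeff g = 1" using lead_p deg_p by simp
  \<comment> \<open>p'(z) = 0 gives z^(n-1) = 1, and then p(z) = (1 - n)(z - 1). So 1 is the only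
    multiple root of \<open>p\<close>, and \<open>g\<close> is squarefree.\<close>
  have p_roots: "z = 1" if "poly p z = 0" "poly (pderiv p) z = 0" for z
  proof -
    have "z ^ (n - 1) = 1" using that(2) n3 by (simp add: p' poly_monom)
    moreover have "z ^ n = z * z ^ (n - 1)" using n3 by (cases n) auto
    ultimately have "(1 - of_nat n) * (z - 1) = 0"
      using that(1) by (simp add: p_def poly_monom algebra_simps)
    then show ?thesis using n3 by auto
  qed
  have "rsquarefree g"
    unfolding rsquarefree_roots
  proof (intro allI notI, elim conjE)
    fix z assume z: "poly g z = 0" "poly (pderiv g) z = 0"
    then have "poly p z = 0" "poly (pderiv p) z = 0"
      unfolding p_eq pderiv_mult by simp_all
    then show False using p_roots g1 z by auto
  qed
  then have g_prod: "(\<Prod>z | poly g z = 0. [:- z, 1:]) = g"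
    using complex_poly_decompose_rsquarefree[of g] lead_g by simp
  have "degree (\<Prod>z | poly g z = 0. [:- z, 1:]) = card {z. poly g z = 0}"
    by (subst degree_prod_eq_sum_degree) auto
  then have "card {z. poly g z = 0} = n - 2" using g_prod deg_g by simp
  moreover have "card (- {i, j}) = n - 2"
    using ij by (simp add: Compl_eq_Diff_UNIV card_Diff_subset n_def)
  ultimately obtain h where h: "bij_betw h (- {i, j}) {z. poly g z = 0}"
    using finite_same_card_bij[of "- {i, j}" "{z. poly g z = 0}"] poly_roots_finite[OF g_ne] by auto
  define y where "y l = (if l = i \<or> l = j then 1 else h l)" for l
  have h_root: "poly g (h l) = 0" if "l \<noteq> i" "l \<noteq> j" for l using h that by (auto simp: bij_betw_def)
  show thesis
  proof
    show "y i = 1" "y j = 1" by (simp_all add: y_def)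
    show "inj_on y (- {i})"
    proof (rule inj_onI)
      fix k l assume kl: "k \<in> - {i}" "l \<in> - {i}" "y k = y l"
      show "k = l"
      proof (cases "k = j \<or> l = j")
        case True
        then show ?thesis using kl h_root g1 by (auto simp: y_def split: if_splits) metis+
      next
        case False
        then show ?thesis using kl h by (auto simp: y_def bij_betw_def inj_on_def)
      qed
    qed
    have "(of_nat n :: complex) \<noteq> of_nat 1" using n3 by (simp only: of_nat_eq_iff)
    then have "poly p 0 \<noteq> 0" using n3 by (simp add: p_def poly_monom power_0_left)
    then have "poly g 0 \<noteq> 0" unfolding p_eq by auto
    then show "y l \<noteq> 0" for l using h_root[of l] by (auto simp: y_def)
    fix k assume k: "1 \<le> k" "k \<le> card (UNIV :: 'n set) - 2"
    have "(\<Prod>l\<in>UNIV. [:- y l, 1:]) = (\<Prod>l\<in>{i, j}. [:- y l, 1:]) * (\<Prod>l\<in>- {i, j}. [:- y l, 1:])"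
      by (subst prod.union_disjoint[symmetric]) (auto simp: Compl_partition)
    also have "(\<Prod>l\<in>- {i, j}. [:- y l, 1:]) = (\<Prod>l\<in>- {i, j}. [:- h l, 1:])"
      by (intro prod.cong) (auto simp: y_def)
    also have "\<dots> = g"
      using prod.reindex_bij_betw[OF h, of "\<lambda>z. [:- z, 1:]"] g_prod by simp
    also have "(\<Prod>l\<in>{i, j}. [:- y l, 1:]) = [:-1, 1:] * [:-1, 1:]"
      using ij by (simp add: y_def)
    finally have "(\<Prod>l\<in>UNIV. [:- y l, 1:]) = p" by (simp only: p_eq mult.assoc)
    then show "(\<Sum>i\<in>UNIV. y i ^ k) = 0"
      using psum_eq_0_if_trinomial[of y] k n by (simp add: p_def n_def)
  qed
qed

text \<open>The roots of T^n - T: 0 at \<open>i\<close>, which scaling leaves fixed, and the (n -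
  1)-th roots of unity at the other indices.\<close>

lemma scaling_base_point:
  fixes i :: "'n::finite"
  assumes n: "card (UNIV :: 'n set) \<ge> 3"
  obtains y :: "'n \<Rightarrow> complex" where "y i = 0" "inj_on y (- {i})" "\<And>l. l \<noteq> i \<Longrightarrow> y l \<noteq> 0"
    "\<And>k. 1 \<le> k \<Longrightarrow> k \<le> card (UNIV :: 'n set) - 2 \<Longrightarrow> (\<Sum>i\<in>UNIV. y i ^ k) = 0"
proof -
  define n where "n = card (UNIV :: 'n set)"
  have n3: "n \<ge> 3" using n by (simp add: n_def)
  have "card (- {i}) = card {z::complex. z ^ (n - 1) = 1}"
    using n3 card_roots_unity_eq[of "n - 1"] by (simp add: Compl_eq_Diff_UNIV card_Diff_subset n_def)
  then obtain h where h: "bij_betw h (- {i}) {z::complex. z ^ (n - 1) = 1}"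
    using finite_same_card_bij[of "- {i}" "{z::complex. z ^ (n - 1) = 1}"] finite_nth_roots[of "n - 1" 1] n3 by auto
  have h1: "h l ^ (n - 1) = 1" if "l \<noteq> i" for l using h that by (auto simp: bij_betw_def)
  have h0: "h l \<noteq> 0" if "l \<noteq> i" for l using h1[OF that] n3 by (auto simp: power_0_left)
  define y where "y l = (if l = i then 0 else h l)" for l
  show thesis
  proof
    show "y i = 0" by (simp add: y_def)
    show inj: "inj_on y (- {i})" using h by (auto simp: y_def bij_betw_def inj_on_def)
    show nz: "y l \<noteq> 0" if "l \<noteq> i" for l using h0[OF that] that by (simp add: y_def)
    fix k assume k: "1 \<le> k" "k \<le> card (UNIV :: 'n set) - 2"
    have "monom 1 n + [:0, - 1:] = (\<Prod>l\<in>UNIV. [:- y l, 1:])"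
    proof (rule prod_linear_eqI)
      show "inj_on y UNIV"
      proof (rule inj_onI)
        fix k l assume "y k = y l"
        then show "k = l" using inj nz[of k] nz[of l] \<open>y i = 0\<close> by (cases "k = i"; cases "l = i") (auto simp: inj_on_def)
      qed
      show "poly (monom 1 n + [:0, - 1:]) (y l) = 0" for l
      proof -
        have "y l ^ n = y l * y l ^ (n - 1)" using n3 by (cases n) auto
        then show ?thesis using h1[of l] by (auto simp: poly_monom y_def)
      qed
      show "degree (monom (1::complex) n + [:0, - 1:]) \<le> card (UNIV :: 'n set)"
        using n3 by (intro degree_add_le) (auto simp: degree_monom_eq n_def)
      show "coeff (monom (1::complex) n + [:0, - 1:]) (card (UNIV :: 'n set)) = 1"
        using n3 by (cases n) (auto simp: coeff_pCons n_def[symmetric] split: nat.splits)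
    qed simp
    then show "(\<Sum>i\<in>UNIV. y i ^ k) = 0"
      using psum_eq_0_if_trinomial[of y 0 "- 1"] k n by (simp add: n_def)
  qed
qed

section \<open>From base points to point data by \<open>a\<close>-th roots\<close>

lemma complex_root_exists:
  assumes "a \<ge> 1" shows "\<exists>w :: complex. w ^ a = c"
proof (cases "c = 0")
  case True
  then show ?thesis using assms by (intro exI[of _ 0]) (simp add: power_0_left)
next
  case False
  then have "card {w. w ^ a = c} \<noteq> 0" using card_nth_roots[of c a] assms by simp
  then have "{w. w ^ a = c} \<noteq> {}" by force
  then show ?thesis by blast
qed

text \<open>The bound \<open>m < n - 1\<close>, with n the number of variables, leaves at least two
  free coordinates, so \<open>i\<close> and \<open>j\<close> both fit into
  \<open>Fr\<close>.\<close>

lemma point_data_exists: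
  fixes y :: "'n::finite \<Rightarrow> complex"
  assumes a: "a \<ge> 1" and m: "m < card (UNIV :: 'n set) - 1"
    and inj: "inj_on y (- {i})" and nz: "\<And>l. l \<noteq> i \<Longrightarrow> y l \<noteq> 0"
    and psum: "\<And>k. 1 \<le> k \<Longrightarrow> k \<le> card (UNIV :: 'n set) - 2 \<Longrightarrow> (\<Sum>i\<in>UNIV. y i ^ k) = 0"
    and \<rho>: "\<And>l. \<rho> l ^ a = y l" 
  obtains Fr ix where "i \<in> Fr" "j \<in> Fr" "point_data a m \<rho> Fr ix"
proof -
  let ?n = "card (UNIV :: 'n set)"
  have "card {i, j} \<le> ?n - m" using m by (cases "i = j") auto
  then obtain Fr where Fr: "{i, j} \<subseteq> Fr" "card Fr = ?n - m"
    using exists_subset_between[of "{i, j}" "?n - m" UNIV] by auto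
  obtain ix :: "'n \<Rightarrow> nat" where "inj ix"
    using finite_imp_inj_to_nat_seg[OF finite[of "UNIV :: 'n set"]] by blast
  moreover have "inj_on y (- Fr)" using Fr by (intro inj_on_subset[OF inj]) auto
  moreover have "\<rho> l \<noteq> 0" if "l \<notin> Fr" for l
  proof -
    have "\<rho> l ^ a \<noteq> 0" using that Fr nz[of l] by (auto simp: \<rho>)
    then show ?thesis using a by (auto simp: power_0_left)
  qed
  ultimately have "point_data a m \<rho> Fr ix"
    using Fr a m psum by unfold_locales (auto simp: \<rho>)
  then show thesis using Fr that by blast
qed

lemma swap_data_exists:
  fixes i j :: "'n::finite"
  assumes n: "card (UNIV :: 'n set) \<ge> 3" and a: "a \<ge> 1" and m: "m < card (UNIV :: 'n set) - 1"
    and ij: "i \<noteq> j"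
  obtains \<rho> Fr ix where "i \<in> Fr" "j \<in> Fr" "\<rho> i = \<rho> j" "point_data a m \<rho> Fr ix"
proof (rule swap_base_point[OF n ij])
  fix y :: "'n \<Rightarrow> complex" assume y: "y i = 1" "y j = 1" "inj_on y (- {i})" "\<And>l. y l \<noteq> 0"
    "\<And>k. 1 \<le> k \<Longrightarrow> k \<le> card (UNIV :: 'n set) - 2 \<Longrightarrow> (\<Sum>i\<in>UNIV. y i ^ k) = 0"
  \<comment> \<open>Choosing the same \<open>a\<close>-th root at \<open>i\<close> and
    \<open>j\<close> puts \<open>\<rho>\<close> itself on the mirror, not only its
    \<open>a\<close>-th powers.\<close>
  define \<rho> where "\<rho> l = (if l = i \<or> l = j then 1 else SOME w. w ^ a = y l)" for l
  have "\<rho> l ^ a = y l" for l using y(1,2) someI_ex[OF complex_root_exists[OF a, of "y l"]] by (auto simp: \<rho>_def)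
  then obtain Fr ix where "i \<in> Fr" "j \<in> Fr" "point_data a m \<rho> Fr ix"
    using point_data_exists[OF a m y(3) y(4) y(5), of \<rho> j] by blast
  then show thesis by (intro that[of Fr \<rho> ix]) (simp_all add: \<rho>_def)
qed

lemma scaling_data_exists:
  fixes i :: "'n::finite"
  assumes n: "card (UNIV :: 'n set) \<ge> 3" and a: "a \<ge> 1" and m: "m < card (UNIV :: 'n set) - 1"
  obtains \<rho> Fr ix where "i \<in> Fr" "\<rho> i = 0" "point_data a m \<rho> Fr ix"
proof (rule scaling_base_point[OF n, of i])
  fix y :: "'n \<Rightarrow> complex" assume y: "y i = 0" "inj_on y (- {i})" "\<And>l. l \<noteq> i \<Longrightarrow> y l \<noteq> 0"
    "\<And>k. 1 \<le> k \<Longrightarrow> k \<le> card (UNIV :: 'n set) - 2 \<Longrightarrow> (\<Sum>i\<in>UNIV. y i ^ k) = 0"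
  define \<rho> where "\<rho> l = (SOME w. w ^ a = y l)" for l
  have \<rho>: "\<rho> l ^ a = y l" for l using someI_ex[OF complex_root_exists[OF a, of "y l"]] by (auto simp: \<rho>_def)
  then have "\<rho> i ^ a = 0" using y(1) by simp
  then have "\<rho> i = 0" by simp
  then show thesis using point_data_exists[OF a m y(2) y(3) y(4) \<rho>, of i] that by auto
qed

section \<open>Primality\<close>

text \<open>Transpositions and scalings of one coordinate generate the monomial group. Each
  generator gets its own base point and free set, adapted to its mirror, while the ideal stays the
  same.\<close>

lemma act_stable:
  fixes \<pi> :: "'n::finite \<Rightarrow> 'n"
  assumes n: "card (UNIV :: 'n set) \<ge> 3" and a: "a \<ge> 1" and m: "m < card (UNIV :: 'n set) - 1"
    and \<pi>: "\<pi> permutes UNIV" and z: "\<And>i. z i ^ a = 1"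
    and fg: "f * g \<in> psum_ideal a m"
  shows "f * act \<pi> z g \<in> psum_ideal a m"
proof -
  have swap_step: "f * act (transpose i j) (\<lambda>_. 1) g \<in> psum_ideal a m"
    if fg: "f * g \<in> psum_ideal a m" for i j :: 'n and f g
  proof (cases "i = j")
    case True
    then have "transpose i j = id" by simp
    then show ?thesis using fg by (simp only: act_id)
  next
    case False
    obtain \<rho> Fr ix where d: "i \<in> Fr" "j \<in> Fr" "\<rho> i = \<rho> j" "point_data a m \<rho> Fr ix"
      using swap_data_exists[OF n a m False] .
    interpret point_data a m \<rho> Fr ix by fact
    show ?thesis
      by (rule mirror_stable[OF _ _ _ _ fg]) (use d in \<open>auto simp: permutes_swap_id transpose_def\<close>)
  qed
  have scale: "f * act id ((\<lambda>_. 1)(i := w)) g \<in> psum_ideal a m"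
    if fg: "f * g \<in> psum_ideal a m" and w: "w ^ a = 1" for i :: 'n and w f g
  proof -
    obtain \<rho> Fr ix where d: "i \<in> Fr" "\<rho> i = 0" "point_data a m \<rho> Fr ix"
      using scaling_data_exists[OF n a m] .
    interpret point_data a m \<rho> Fr ix by fact
    show ?thesis
      by (rule mirror_stable[OF _ _ _ _ fg]) (use d w in \<open>auto simp: permutes_id\<close>)
  qed
  have "f * act id (\<lambda>i. if i \<in> A then z i else 1) g \<in> psum_ideal a m" for A
    using finite[of A]
  proof (induction A rule: finite_induct)
    case empty
    show ?case using fg by (simp only: empty_iff if_False act_id)
  next
    case (insert x A)
    have "act id ((\<lambda>_. 1)(x := z x)) (act id (\<lambda>i. if i \<in> A then z i else 1) g) =
        act id (\<lambda>i. if i \<in> insert x A then z i else 1) g"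
      unfolding act_act using insert.hyps by (intro arg_cong2[of _ _ _ _ "\<lambda>p s. act p s g"]) auto
    then show ?case using scale[OF insert.IH z[of x], of x] by (simp only:)
  qed
  from this[of UNIV] have scaled: "f * act id z g \<in> psum_ideal a m" by simp
  have "f * act \<pi> (\<lambda>_. 1) (act id z g) \<in> psum_ideal a m"
    using \<pi> finite[of "UNIV :: 'n set"]
  proof (induction rule: permutes_induct)
    case id
    show ?case using scaled by (simp only: act_id)
  next
    case (swap b c p)
    have "act (transpose b c \<circ> p) (\<lambda>_. 1) (act id z g) = act (transpose b c) (\<lambda>_. 1) (act p (\<lambda>_. 1) (act id z g))"
      by (simp add: act_act o_def)
    then show ?case using swap_step[OF swap.IH, of b c] by (simp only:)
  qed
  then show ?thesis by (simp add: act_act o_def)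
qed

theorem theorem3p12:
  fixes a m :: nat and I :: "('n::finite) cpoly set"
  assumes "card (UNIV :: 'n set) \<ge> 3"
    and "a \<ge> 1"
    and "m \<ge> 1"
    and "m < card (UNIV :: 'n set) - 1"
    and "I = ideal_gen {power_sum (k * a) | k. 1 \<le> k \<and> k \<le> m}"
  shows "prime_ideal I"
proof -
  obtain i j :: 'n where "i \<noteq> j"
    using assms(1) card_le_Suc0_iff_eq[OF finite[of "UNIV :: 'n set"]] by auto
  then obtain \<rho> and Fr :: "'n set" and ix where "point_data a m \<rho> Fr ix"
    using swap_data_exists[OF assms(1,2,4)] by blast
  then interpret point_data a m \<rho> Fr ix .
  have "1 \<notin> I"
    using psum_ideal_vanishes[OF \<xi>_in_V, of 1] by (auto simp: assms(5) rhom.hom_one[OF rhom_ev_scal])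
  moreover have "f \<in> I \<or> g \<in> I" if fg: "f * g \<in> I" for f g
  proof (rule ccontr)
    assume "\<not> (f \<in> I \<or> g \<in> I)"
    \<comment> \<open>Both points are translates of \<open>\<xi>\<close> under the monomial group.
      Acting on the two factors separately yields a product in \<open>I\<close> whose factors are
      both nonzero at the single point \<open>\<xi>\<close>.\<close>
    then obtain \<zeta> \<zeta>' where \<zeta>: "\<zeta> \<in> V" "ev scal \<zeta> f \<noteq> 0" and \<zeta>': "\<zeta>' \<in> V" "ev scal \<zeta>' g \<noteq> 0"
      using vanishing_imp_mem unfolding assms(5) by blast
    obtain \<pi> z where \<pi>: "\<zeta> = (\<lambda>i. scal (z i) * \<xi> (\<pi> i))" "\<pi> permutes UNIV" "\<And>i. z i ^ a = 1"
      using \<zeta>(1) permutes_subset unfolding V_def by blast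
    obtain \<pi>' z' where \<pi>': "\<zeta>' = (\<lambda>i. scal (z' i) * \<xi> (\<pi>' i))" "\<pi>' permutes UNIV" "\<And>i. z' i ^ a = 1"
      using \<zeta>'(1) permutes_subset unfolding V_def by blast
    have "act \<pi>' z' g * f \<in> I"
      using act_stable[OF assms(1,2,4) \<pi>'(2,3), of f g] fg by (simp add: assms(5) mult.commute)
    then have "act \<pi>' z' g * act \<pi> z f \<in> I"
      using act_stable[OF assms(1,2,4) \<pi>(2,3)] by (simp add: assms(5))
    then have "ev scal \<xi> (act \<pi>' z' g) * ev scal \<xi> (act \<pi> z f) = 0"
      unfolding assms(5) rhom.hom_mult[OF rhom_ev_scal, symmetric] by (rule psum_ideal_vanishes[OF \<xi>_in_V])
    then show False using \<zeta>(2) \<zeta>'(2) by (simp add: ev_scal_act \<pi>(1) \<pi>'(1))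
  qed
  ultimately show ?thesis
    using is_ideal_ideal_gen unfolding prime_ideal_def assms(5) by blast
qed

end
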